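(* Let $\mathcal{G}=(H,\sigma,\alpha,h_0)$ be a rooted combinatorial map with underlying graph $G=(V,E)$. The mapping $\Phi$ is a bijection from the set of subgraphs ($=$ subsets of $E$) of $G$ to the set of orientations of $G$.
   Context: A rooted combinatorial map is $\mathcal{G}=(H,\sigma,\alpha,h_0)$ with $H$ a finite set of half-edges, $\sigma$ a permutation, $\alpha$ a fixed-point-free involution, $\langle\sigma,\alpha\rangle$ transitive on $H$, root $h_0$; its underlying graph has the cycles of $\sigma$ as vertices and the pairs $\{h,\alpha(h)\}$ as edges (loops, multiple edges allowed). Subgraphs are spanning and identified with edge sets. An orientation assigns to each edge $e=\{h,h'\}$ an ordered pair, $(h,h')$ or $(h',h)$; in $(h,h')$, $h$ is the tail and $h'$ the head. For a spanning tree $T$: edges in $T$ are internal, others external; the motion function $t(h)=\sigma\alpha(h)$ if the edge of $h$ is internal, $\sigma(h)$ otherwise, is a cyclic permutation of $H$; the $(\mathcal{G},T)$-order on $H$ is $h_0<t(h_0)<\dots<t^{|H|-1}(h_0)$, edges compared via their smaller half-edge. The fundamental cycle of an external edge $e$ is the set of $e'$ with $T-e'+e$ a spanning tree; the fundamental cocycle of an internal edge $e$ is the set of $e'$ with $T-e+e'$ a spanning tree; an edge is $(\mathcal{G},T)$-active if minimal in its fundamental cycle (external) or cocycle (internal). The tree-interval $[T^-,T^+]$ is the set of subgraphs obtained from $T$ by removing some internal active edges and adding some external active edges; every subgraph $S$ lies in exactly one tree-interval $[T^-,T^+]$. The mapping $\Phi$: for $S\in[T^-,T^+]$ and each edge $e=\{h_1,h_2\}$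 with $h_1<h_2$ in the $(\mathcal{G},T)$-order, $\Phi(S)(e)=(h_1,h_2)$ if either ($e\in T$ and the fundamental cocycle of $e$ contains no edge of $S\triangle T$) or ($e\notin T$ and the fundamental cycle of $e$ contains some edge of $S\triangle T$); otherwise $\Phi(S)(e)=(h_2,h_1)$. *)

theory Defs
  imports Main "HOL-Library.FuncSet" "HOL-Combinatorics.Permutations" "HOL-Combinatorics.Orbits"
begin

inductive_set generated_perms :: "('h \<Rightarrow> 'h) set \<Rightarrow> ('h \<Rightarrow> 'h) set" for F where
  gen_id: "id \<in> generated_perms F"
| gen_comp: "f \<in> F \<Longrightarrow> g \<in> generated_perms F \<Longrightarrow> f \<circ> g \<in> generated_perms F"
| gen_inv: "f \<in> F \<Longrightarrow> g \<in> generated_perms F \<Longrightarrow> inv f \<circ> g \<in> generated_perms F"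

locale rooted_map =
  fixes H :: "'h set" and \<sigma> \<alpha> :: "'h \<Rightarrow> 'h" and h0 :: 'h
  assumes finite_H: "finite H"
    and sigma_permutes: "\<sigma> permutes H"
    and alpha_permutes: "\<alpha> permutes H"
    and alpha_involution: "h \<in> H \<Longrightarrow> \<alpha> (\<alpha> h) = h"
    and alpha_no_fixpoint: "h \<in> H \<Longrightarrow> \<alpha> h \<noteq> h"
    and transitive: "h \<in> H \<Longrightarrow> h' \<in> H \<Longrightarrow> \<exists>g \<in> generated_perms {\<sigma>, \<alpha>}. g h = h'"
    and root_in_H: "h0 \<in> H"
begin

definition vertex_of :: "'h \<Rightarrow> 'h set" where
  "vertex_of h = orbit \<sigma> h"

definition edge_of :: "'h \<Rightarrow> 'h set" where
  "edge_of h = {h, \<alpha> h}"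

definition vertices :: "'h set set" where
  "vertices = vertex_of ` H"

definition edges :: "'h set set" where
  "edges = edge_of ` H"

definition subgraphs :: "'h set set set" where
  "subgraphs = Pow edges"

definition adjacent :: "'h set set \<Rightarrow> ('h set \<times> 'h set) set" where
  "adjacent S = {(vertex_of h, vertex_of (\<alpha> h)) | h. h \<in> H \<and> edge_of h \<in> S}"

definition connected_subgraph :: "'h set set \<Rightarrow> bool" where
  "connected_subgraph S \<longleftrightarrow> (\<forall>u \<in> vertices. \<forall>v \<in> vertices. (u, v) \<in> (adjacent S)\<^sup>*)"

text \<open>A simple cycle is given by the half-edges through which it leaves its successive
  vertices. Distinctness of edges is required separately so that going back and forth along one
  edge is not a cycle, whereas a loop (length 1) and a pair of parallel edges (length 2) are.\<close>

definition simple_cycle :: "'h list \<Rightarrow> bool" where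
  "simple_cycle hs \<longleftrightarrow> hs \<noteq> [] \<and> set hs \<subseteq> H \<and>
     distinct (map vertex_of hs) \<and> distinct (map edge_of hs) \<and>
     (\<forall>i < length hs. vertex_of (\<alpha> (hs ! i)) = vertex_of (hs ! (Suc i mod length hs)))"

definition acyclic_subgraph :: "'h set set \<Rightarrow> bool" where
  "acyclic_subgraph S \<longleftrightarrow> \<not> (\<exists>hs. simple_cycle hs \<and> edge_of ` set hs \<subseteq> S)"

definition spanning_tree :: "'h set set \<Rightarrow> bool" where
  "spanning_tree T \<longleftrightarrow> T \<in> subgraphs \<and> connected_subgraph T \<and> acyclic_subgraph T"

definition motion :: "'h set set \<Rightarrow> 'h \<Rightarrow> 'h" where
  "motion T h = (if edge_of h \<in> T then \<sigma> (\<alpha> h) else \<sigma> h)"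

text \<open>The rank of \<open>h\<close> in the sequence \<open>h0, t h0, t (t h0), \<dots>\<close>, where \<open>t = motion T\<close>.\<close>

definition half_edge_rank :: "'h set set \<Rightarrow> 'h \<Rightarrow> nat" where
  "half_edge_rank T h = (LEAST n. (motion T ^^ n) h0 = h)"

definition half_edge_less :: "'h set set \<Rightarrow> 'h \<Rightarrow> 'h \<Rightarrow> bool" where
  "half_edge_less T h h' \<longleftrightarrow> half_edge_rank T h < half_edge_rank T h'"

definition smaller_half_edge :: "'h set set \<Rightarrow> 'h set \<Rightarrow> 'h" where
  "smaller_half_edge T e = (THE h. h \<in> e \<and> half_edge_less T h (\<alpha> h))"

definition edge_less :: "'h set set \<Rightarrow> 'h set \<Rightarrow> 'h set \<Rightarrow> bool" where
  "edge_less T e e' \<longleftrightarrow> half_edge_less T (smaller_half_edge T e) (smaller_half_edge T e')"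

text \<open>In \<open>T - e' + e\<close> the edge \<open>e\<close> is added before \<open>e'\<close> is removed, so that an external edge
  belongs to its own fundamental cycle.\<close>

definition fundamental_cycle :: "'h set set \<Rightarrow> 'h set \<Rightarrow> 'h set set" where
  "fundamental_cycle T e = {e' \<in> edges. spanning_tree (insert e T - {e'})}"

definition fundamental_cocycle :: "'h set set \<Rightarrow> 'h set \<Rightarrow> 'h set set" where
  "fundamental_cocycle T e = {e' \<in> edges. spanning_tree (insert e' (T - {e}))}"

definition internal_active :: "'h set set \<Rightarrow> 'h set set" where
  "internal_active T = {e \<in> T. \<not> (\<exists>e' \<in> fundamental_cocycle T e. edge_less T e' e)}"

definition external_active :: "'h set set \<Rightarrow> 'h set set" where
  "external_active T = {e \<in> edges - T. \<not> (\<exists>e' \<in> fundamental_cycle T e. edge_less T e' e)}"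

definition tree_interval :: "'h set set \<Rightarrow> 'h set set set" where
  "tree_interval T = {(T - A) \<union> B | A B. A \<subseteq> internal_active T \<and> B \<subseteq> external_active T}"

definition tree_of :: "'h set set \<Rightarrow> 'h set set" where
  "tree_of S = (THE T. spanning_tree T \<and> S \<in> tree_interval T)"

text \<open>An orientation maps each edge to its (tail, head) pair. Since these are functions on the
  edge set, they are taken to be \<open>undefined\<close> elsewhere.\<close>

definition orientations :: "('h set \<Rightarrow> 'h \<times> 'h) set" where
  "orientations = (\<Pi>\<^sub>E e \<in> edges. {(h, h'). e = {h, h'}})"

definition \<Phi> :: "'h set set \<Rightarrow> 'h set \<Rightarrow> 'h \<times> 'h" where
  "\<Phi> S = (\<lambda>e \<in> edges.
     let T = tree_of S;
         D = (S - T) \<union> (T - S);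
         h\<^sub>1 = smaller_half_edge T e;
         h\<^sub>2 = \<alpha> h\<^sub>1
     in if (e \<in> T \<and> fundamental_cocycle T e \<inter> D = {}) \<or>
           (e \<notin> T \<and> fundamental_cycle T e \<inter> D \<noteq> {})
        then (h\<^sub>1, h\<^sub>2) else (h\<^sub>2, h\<^sub>1))"

end

end

theory Submission
  imports Defs "HOL-Library.List_Lexorder"
begin

text \<open>
  For an internal edge \<open>e = {a, \<alpha> a}\<close> of \<open>T\<close>, the half-edges beyond \<open>e\<close> are exactly those visited after
  \<open>a\<close> and up to \<open>\<alpha> a\<close>, so fundamental cycles and cocycles are read off from the order. The tours of two
  distinct spanning trees agree until the first edge on which the trees differ, and that edge has
  the same predecessors in both orders. Comparing the fundamental cocycle of this edge in one tree
  with its fundamental cycle in the other shows that tree-intervals are disjoint; that they cover all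
  subgraphs follows by a lexicographic maximality argument.

  In \<open>\<Phi> S\<close> the fundamental cycles of the active external edges in \<open>S \<triangle> T\<close> and the fundamental cocycles
  of the active internal edges in \<open>S \<triangle> T\<close> are directed. A directed cycle and a directed cocycle
  of the same orientation have no common edge, even when they come from different trees; applied at
  the first difference of two trees this gives the injectivity of \<open>\<Phi>\<close>. Subgraphs and orientations are
  equinumerous, so \<open>\<Phi>\<close> is bijective.
\<close>

context rooted_map
begin

subsection \<open>Connectivity and spanning trees\<close>

text \<open>Activity is what makes the cycles and cocycles directed. The tour intervals of an
  internal and an external edge that can be exchanged interleave, and the one that starts first
  decides which end of the external edge lies beyond the internal one. An active edge starts before
  all its partners, so one choice of directions fits its whole cycle or cocycle. At the first
  difference of \<open>T\<close> and \<open>T'\<close>, a path of \<open>T'\<close> leaving a cut of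
  \<open>T\<close> supplies an edge of \<open>T'\<close> outside \<open>T\<close> that comes later
  than the difference in both orders. This edge serves both the disjointness of tree-intervals and
  each case of injectivity. The map may have any genus, so no duality swaps cycles with cocycles and
  both are treated by hand.\<close>

lemma alpha_in_H [simp]: "h \<in> H \<Longrightarrow> \<alpha> h \<in> H"
  using alpha_permutes by (simp add: permutes_in_image)

lemma sigma_in_H [simp]: "\<sigma> h \<in> H \<longleftrightarrow> h \<in> H"
  using sigma_permutes by (simp add: permutes_in_image)

declare alpha_involution [simp]

lemma edge_of_alpha [simp]: "h \<in> H \<Longrightarrow> edge_of (\<alpha> h) = edge_of h"
  by (auto simp: edge_of_def)

lemma edge_of_in_edges [simp]: "h \<in> H \<Longrightarrow> edge_of h \<in> edges"
  by (simp add: edges_def)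

lemma edge_of_eq_iff: "x \<in> H \<Longrightarrow> y \<in> H \<Longrightarrow> edge_of x = edge_of y \<longleftrightarrow> x = y \<or> x = \<alpha> y"
  unfolding edge_of_def by (metis alpha_involution doubleton_eq_iff)

lemma edgesE:
  assumes "e \<in> edges"
  obtains h where "h \<in> H" "e = edge_of h"
  using assms by (auto simp: edges_def)

lemma finite_edges: "finite edges"
  by (simp add: edges_def finite_H)

lemma permutation_sigma: "permutation \<sigma>"
  using sigma_permutes finite_H by (auto simp: permutation_permutes)

lemma in_vertex_of: "h \<in> vertex_of h"
  by (simp add: vertex_of_def permutation_self_in_orbit permutation_sigma)

lemma vertex_of_sigma [simp]: "vertex_of (\<sigma> h) = vertex_of h"
  unfolding vertex_of_def
  by (metis orbit.base orbit_cyclic_eq3 permutation_sigma cyclic_on_def permutation_self_in_orbit)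

lemma vertex_of_closed:
  assumes "vertex_of x = vertex_of y" "x \<in> X" "x \<in> H"
    and closed: "\<And>h. h \<in> H \<Longrightarrow> h \<in> X \<Longrightarrow> \<sigma> h \<in> X"
  shows "y \<in> X"
proof -
  have "y \<in> orbit \<sigma> x" using assms(1) in_vertex_of[of y] by (simp add: vertex_of_def)
  then have "y \<in> X \<and> y \<in> H"
    by (induction rule: orbit.induct) (use assms in auto)
  then show ?thesis ..
qed

text \<open>Connectivity of vertices is stated for half-edges sitting at them: \<sigma>-steps are
  then free, and invariants can be sets of half-edges such as intervals of a tour.\<close>

definition reach :: "'h set set \<Rightarrow> 'h \<Rightarrow> 'h \<Rightarrow> bool" where
  "reach S x y \<longleftrightarrow> (vertex_of x, vertex_of y) \<in> (adjacent S)\<^sup>*"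

lemma reach_refl [simp]: "reach S x x"
  by (simp add: reach_def)

lemma reach_trans: "reach S x y \<Longrightarrow> reach S y z \<Longrightarrow> reach S x z"
  by (auto simp: reach_def)

lemma sym_adjacent: "sym (adjacent S)"
proof (rule symI)
  fix u v assume "(u, v) \<in> adjacent S"
  then obtain h where "u = vertex_of h" "v = vertex_of (\<alpha> h)" "h \<in> H" "edge_of h \<in> S"
    by (auto simp: adjacent_def)
  then show "(v, u) \<in> adjacent S"
    by (auto simp: adjacent_def intro!: exI[of _ "\<alpha> h"])
qed

lemma reach_sym: "reach S x y \<Longrightarrow> reach S y x"
  unfolding reach_def by (meson sym_adjacent sym_rtrancl symD)

lemma reach_sigma [simp]: "reach S x (\<sigma> y) \<longleftrightarrow> reach S x y"
  by (simp add: reach_def)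

lemma reach_alpha: "x \<in> H \<Longrightarrow> edge_of x \<in> S \<Longrightarrow> reach S x (\<alpha> x)"
  unfolding reach_def adjacent_def by (rule r_into_rtrancl) auto

lemma reach_mono: "reach S x y \<Longrightarrow> S \<subseteq> S' \<Longrightarrow> reach S' x y"
proof -
  assume "reach S x y" "S \<subseteq> S'"
  moreover from this have "adjacent S \<subseteq> adjacent S'" by (auto simp: adjacent_def)
  ultimately show ?thesis unfolding reach_def using rtrancl_mono by blast
qed

text \<open>The induction principle behind most connectivity arguments below. Closure under forward
  \<sigma>-steps suffices, since the orbit of a permutation of a finite set is exhausted by forward
  iteration.\<close>

lemma reach_closed:
  assumes "reach S x y" "x \<in> H" "y \<in> H" "x \<in> X"
    and sig: "\<And>h. h \<in> H \<Longrightarrow> h \<in> X \<Longrightarrow> \<sigma> h \<in> X"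
    and alp: "\<And>h. h \<in> H \<Longrightarrow> h \<in> X \<Longrightarrow> edge_of h \<in> S \<Longrightarrow> \<alpha> h \<in> X"
  shows "y \<in> X"
proof -
  have "(vertex_of x, v) \<in> (adjacent S)\<^sup>* \<Longrightarrow> \<forall>h \<in> H. vertex_of h = v \<longrightarrow> h \<in> X" for v
  proof (induction rule: rtrancl_induct)
    case base
    then show ?case using vertex_of_closed[of x _ X] assms by metis
  next
    case (step v w)
    then obtain h where h: "v = vertex_of h" "w = vertex_of (\<alpha> h)" "h \<in> H" "edge_of h \<in> S"
      by (auto simp: adjacent_def)
    then have "\<alpha> h \<in> X" using step.IH alp by blast
    then show ?case using vertex_of_closed[of "\<alpha> h" _ X] h sig by (metis alpha_in_H)
  qed
  then show ?thesis using assms by (auto simp: reach_def)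
qed

lemma connected_subgraph_iff: "connected_subgraph S \<longleftrightarrow> (\<forall>x \<in> H. \<forall>y \<in> H. reach S x y)"
  by (auto simp: connected_subgraph_def reach_def vertices_def)

section \<open>Simple walks and acyclicity through bridges\<close>

fun walk :: "'h set set \<Rightarrow> 'h set \<Rightarrow> 'h list \<Rightarrow> 'h set \<Rightarrow> bool" where
  "walk S v [] w \<longleftrightarrow> v = w"
| "walk S v (h # hs) w \<longleftrightarrow>
     h \<in> H \<and> vertex_of h = v \<and> edge_of h \<in> S \<and> walk S (vertex_of (\<alpha> h)) hs w"

lemma walk_append_Cons: "walk S v (p @ h # q) w \<Longrightarrow> walk S (vertex_of h) (h # q) w"
  by (induction p arbitrary: v) auto

lemma exists_simple_walk:
  assumes "(v, w) \<in> (adjacent S)\<^sup>*"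
  shows "\<exists>hs. walk S v hs w \<and> distinct (map vertex_of hs @ [w])"
  using assms
proof (induction rule: converse_rtrancl_induct)
  case base
  show ?case by (rule exI[of _ "[]"]) simp
next
  case (step u v)
  then obtain hs where hs: "walk S v hs w" "distinct (map vertex_of hs @ [w])" by blast
  obtain h where h: "u = vertex_of h" "v = vertex_of (\<alpha> h)" "h \<in> H" "edge_of h \<in> S"
    using step.hyps by (auto simp: adjacent_def)
  consider "u = w" | "u \<in> vertex_of ` set hs" | "u \<noteq> w" "u \<notin> vertex_of ` set hs" by blast
  then show ?case
  proof cases
    case 1
    then show ?thesis by (intro exI[of _ "[]"]) simp
  next
    case 2
    then obtain h' where "h' \<in> set hs" "u = vertex_of h'" by blast
    then obtain p q where pq: "hs = p @ h' # q" "u = vertex_of h'" by (meson split_list)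
    then have "walk S u (h' # q) w" using hs walk_append_Cons by blast
    moreover have "distinct (map vertex_of (h' # q) @ [w])" using hs pq by auto
    ultimately show ?thesis by blast
  next
    case 3
    then show ?thesis using hs h by (intro exI[of _ "h # hs"]) auto
  qed
qed

lemma walk_head: "walk S v hs w \<Longrightarrow> h \<in> set hs \<Longrightarrow> vertex_of (\<alpha> h) \<in> insert w (vertex_of ` set hs)"
proof (induction hs arbitrary: v)
  case (Cons g hs)
  show ?case
  proof (cases "h = g")
    case True
    with Cons.prems show ?thesis by (cases hs) auto
  next
    case False
    with Cons show ?thesis by auto
  qed
qed simp

text \<open>Two half-edges of one edge are equal or opposite. Equal ones repeat a vertex; if
  \<open>\<alpha> h\<close> comes before \<open>h\<close>, the walk returns to the vertex of
  \<open>\<alpha> h\<close> right after \<open>h\<close>.\<close>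

lemma walk_distinct_edges:
  "walk S v hs w \<Longrightarrow> distinct (map vertex_of hs @ [w]) \<Longrightarrow> distinct (map edge_of hs)"
proof (induction hs arbitrary: v)
  case (Cons g hs)
  have "edge_of g \<noteq> edge_of h" if "h \<in> set hs" for h
  proof
    assume e: "edge_of g = edge_of h"
    have sub: "set hs \<subseteq> H" using Cons.prems(1)
    proof -
      have "walk S u hs' w \<Longrightarrow> set hs' \<subseteq> H" for u hs' by (induction hs' arbitrary: u) auto
      then show ?thesis using Cons.prems(1) by auto
    qed
    with that have "h \<in> H" by auto
    then have "g = h \<or> g = \<alpha> h" using e edge_of_eq_iff Cons.prems(1) by auto
    moreover have "g \<noteq> h" using that Cons.prems(2) by auto
    moreover have "vertex_of (\<alpha> h) \<in> insert w (vertex_of ` set hs)"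
      using Cons.prems(1) by (intro walk_head[OF _ that]) auto
    ultimately show False using Cons.prems(2) by auto
  qed
  then show ?case using Cons by auto
qed simp

lemma walk_nth:
  "walk S v hs w \<Longrightarrow> set hs \<subseteq> H \<and> edge_of ` set hs \<subseteq> S \<and>
     vertex_of ((hs @ [h]) ! 0) = (if hs = [] then vertex_of h else v) \<and>
     (\<forall>i < length hs. vertex_of h = w \<longrightarrow>
        vertex_of (\<alpha> (hs ! i)) = vertex_of ((hs @ [h]) ! Suc i))"
proof (induction hs arbitrary: v)
  case (Cons g hs)
  from Cons.prems have w: "walk S (vertex_of (\<alpha> g)) hs w" by simp
  note IH = Cons.IH[OF w]
  have "vertex_of (\<alpha> ((g # hs) ! i)) = vertex_of (((g # hs) @ [h]) ! Suc i)"
    if "i < length (g # hs)" "vertex_of h = w" for i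
    using that IH w by (cases i) (auto split: if_splits)
  then show ?case using IH Cons.prems by auto
qed simp

text \<open>Trades cycles given as lists for a bridge condition. A simple walk around an edge that
  is not a bridge closes up to a simple cycle (the empty walk gives a loop); conversely the rest of
  a simple cycle bypasses its first edge.\<close>

lemma acyclic_subgraph_iff:
  "acyclic_subgraph S \<longleftrightarrow> (\<forall>x \<in> H. edge_of x \<in> S \<longrightarrow> \<not> reach (S - {edge_of x}) x (\<alpha> x))"
proof
  assume ac: "acyclic_subgraph S"
  show "\<forall>x \<in> H. edge_of x \<in> S \<longrightarrow> \<not> reach (S - {edge_of x}) x (\<alpha> x)"
  proof (intro ballI impI notI)
    fix x assume x: "x \<in> H" "edge_of x \<in> S" "reach (S - {edge_of x}) x (\<alpha> x)"
    then obtain hs where hs: "walk (S - {edge_of x}) (vertex_of x) hs (vertex_of (\<alpha> x))"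
      "distinct (map vertex_of hs @ [vertex_of (\<alpha> x)])"
      using exists_simple_walk unfolding reach_def by blast
    note nth = walk_nth[OF hs(1), of "\<alpha> x"]
    let ?c = "hs @ [\<alpha> x]"
    have "vertex_of (\<alpha> (?c ! i)) = vertex_of (?c ! (Suc i mod length ?c))"
      if "i < length ?c" for i
    proof (cases "i < length hs")
      case True
      then show ?thesis using nth by (simp add: nth_append)
    next
      case False
      then have "i = length hs" using that by simp
      then show ?thesis using nth x hs by (auto simp: nth_append split: if_splits)
    qed
    moreover have "distinct (map edge_of ?c)"
      using walk_distinct_edges[OF hs] nth x by auto
    ultimately have "simple_cycle ?c"
      unfolding simple_cycle_def using nth x hs by auto
    moreover have "edge_of ` set ?c \<subseteq> S" using nth x by auto
    ultimately show False using ac unfolding acyclic_subgraph_def by blast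
  qed
next
  assume br: "\<forall>x \<in> H. edge_of x \<in> S \<longrightarrow> \<not> reach (S - {edge_of x}) x (\<alpha> x)"
  show "acyclic_subgraph S"
    unfolding acyclic_subgraph_def
  proof
    assume "\<exists>hs. simple_cycle hs \<and> edge_of ` set hs \<subseteq> S"
    then obtain hs where sc: "simple_cycle hs" and sub: "edge_of ` set hs \<subseteq> S" by blast
    let ?n = "length hs" and ?x = "hs ! 0"
    have n: "0 < ?n" and HH: "\<And>i. i < ?n \<Longrightarrow> hs ! i \<in> H"
      and de: "distinct (map edge_of hs)"
      and nx: "\<And>i. i < ?n \<Longrightarrow> vertex_of (\<alpha> (hs ! i)) = vertex_of (hs ! (Suc i mod ?n))"
      using sc unfolding simple_cycle_def by auto
    have "i < ?n \<Longrightarrow> reach (S - {edge_of ?x}) (\<alpha> ?x) (hs ! (Suc i mod ?n))" for i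
    proof (induction i)
      case 0
      then show ?case using nx[of 0] by (simp add: reach_def)
    next
      case (Suc i)
      let ?h = "hs ! Suc i"
      have "edge_of ?h \<noteq> edge_of ?x"
        using de Suc.prems n nth_eq_iff_index_eq[of "map edge_of hs" "Suc i" 0] by auto
      moreover have "edge_of ?h \<in> S" using sub Suc.prems by auto
      ultimately have "reach (S - {edge_of ?x}) ?h (\<alpha> ?h)"
        using HH[OF Suc.prems] by (intro reach_alpha) auto
      then have "reach (S - {edge_of ?x}) ?h (hs ! (Suc (Suc i) mod ?n))"
        using nx[OF Suc.prems] by (simp add: reach_def)
      moreover have "reach (S - {edge_of ?x}) (\<alpha> ?x) ?h" using Suc by simp
      ultimately show ?case using reach_trans by blast
    qed
    from this[of "?n - 1"] have "reach (S - {edge_of ?x}) (\<alpha> ?x) ?x" using n by simp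
    moreover have "edge_of ?x \<in> S" using sub n by auto
    ultimately show False using br HH[OF n] reach_sym by blast
  qed
qed

lemma spanning_tree_iff:
  "spanning_tree T \<longleftrightarrow> T \<subseteq> edges \<and> (\<forall>x \<in> H. \<forall>y \<in> H. reach T x y) \<and>
     (\<forall>x \<in> H. edge_of x \<in> T \<longrightarrow> \<not> reach (T - {edge_of x}) x (\<alpha> x))"
  by (auto simp: spanning_tree_def subgraphs_def connected_subgraph_iff acyclic_subgraph_iff)

lemma spanning_treeD:
  assumes "spanning_tree T"
  shows "T \<subseteq> edges" "x \<in> H \<Longrightarrow> y \<in> H \<Longrightarrow> reach T x y"
    "x \<in> H \<Longrightarrow> edge_of x \<in> T \<Longrightarrow> \<not> reach (T - {edge_of x}) x (\<alpha> x)"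
  using assms unfolding spanning_tree_iff by blast+

text \<open>Transitivity of the generated group is connectedness of the underlying graph: \<sigma>
  and its inverse stay at a vertex, while \<alpha> is its own inverse and crosses an edge.\<close>

lemma reach_edges:
  assumes "x \<in> H" "y \<in> H"
  shows "reach edges x y"
proof -
  obtain g where g: "g \<in> generated_perms {\<sigma>, \<alpha>}" "g x = y" using transitive assms by blast
  have "g \<in> generated_perms {\<sigma>, \<alpha>} \<Longrightarrow> g x \<in> H \<and> reach edges x (g x)" for g
  proof (induction rule: generated_perms.induct)
    case gen_id
    then show ?case using assms by simp
  next
    case (gen_comp f g)
    then have "f = \<sigma> \<or> f = \<alpha>" by auto
    then show ?case
      using gen_comp.IH reach_alpha[of "g x" edges] reach_trans by auto
  next
    case (gen_inv f g)
    then consider "f = \<sigma>" | "f = \<alpha>" by auto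
    then show ?case
    proof cases
      case 1
      have "\<sigma> (inv \<sigma> (g x)) = g x" using sigma_permutes permutes_inverses by metis
      then show ?thesis using gen_inv.IH 1 reach_sigma sigma_in_H
        by (metis comp_apply)
    next
      case 2
      have "inv \<alpha> (g x) = \<alpha> (g x)"
        using gen_inv.IH alpha_involution alpha_permutes permutes_inverses(2) by metis
      then show ?thesis using gen_inv.IH 2 reach_alpha[of "g x" edges] reach_trans by auto
    qed
  qed
  then show ?thesis using g by blast
qed

lemma exists_spanning_tree: "\<exists>T. spanning_tree T"
proof -
  let ?P = "\<lambda>T. T \<subseteq> edges \<and> (\<forall>x \<in> H. \<forall>y \<in> H. reach T x y)"
  have "?P edges" using reach_edges by blast
  then obtain T where T: "?P T" and min: "\<And>T'. ?P T' \<Longrightarrow> card T \<le> card T'"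
    using ex_has_least_nat[of ?P edges card] by blast
  have "\<not> reach (T - {edge_of x}) x (\<alpha> x)" if x: "x \<in> H" "edge_of x \<in> T" for x
  proof
    assume r: "reach (T - {edge_of x}) x (\<alpha> x)"
    have "reach (T - {edge_of x}) y z" if "y \<in> H" "z \<in> H" for y z
    proof -
      have "z \<in> {z. reach (T - {edge_of x}) y z}"
      proof (rule reach_closed[of T y z])
        fix h assume h: "h \<in> H" "h \<in> {z. reach (T - {edge_of x}) y z}" "edge_of h \<in> T"
        have "reach (T - {edge_of x}) h (\<alpha> h)"
        proof (cases "edge_of h = edge_of x")
          case True
          then show ?thesis using edge_of_eq_iff r reach_sym x h by (metis alpha_involution)
        next
          case False
          then show ?thesis using h by (intro reach_alpha) auto
        qed
        then show "\<alpha> h \<in> {z. reach (T - {edge_of x}) y z}" using h reach_trans by auto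
      qed (use T that in auto)
      then show ?thesis by simp
    qed
    then have "?P (T - {edge_of x})" using T by auto
    then have "card T \<le> card (T - {edge_of x})" by (rule min)
    moreover have "finite T" using T finite_edges finite_subset by blast
    ultimately show False using card_Diff1_less[of T "edge_of x"] x by simp
  qed
  then show ?thesis using T spanning_tree_iff by blast
qed

subsection \<open>Exchanging edges\<close>

text \<open>Deleting a tree edge leaves exactly two components, one for each of its half-edges:
  connectedness of \<open>T\<close> puts every half-edge in one of them, and the bridge property
  keeps them apart.\<close>

lemma split_by_bridge:
  assumes "spanning_tree T" "a \<in> H" "edge_of a \<in> T" "y \<in> H"
  shows "reach (T - {edge_of a}) (\<alpha> a) y \<longleftrightarrow> \<not> reach (T - {edge_of a}) a y"
proof
  assume "reach (T - {edge_of a}) (\<alpha> a) y"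
  then show "\<not> reach (T - {edge_of a}) a y"
    using spanning_treeD(3)[OF assms(1-3)] reach_sym reach_trans by blast
next
  let ?X = "{y. reach (T - {edge_of a}) a y \<or> reach (T - {edge_of a}) (\<alpha> a) y}"
  have "y \<in> ?X"
  proof (rule reach_closed[of T a y])
    fix h assume h: "h \<in> H" "h \<in> ?X" "edge_of h \<in> T"
    show "\<alpha> h \<in> ?X"
    proof (cases "edge_of h = edge_of a")
      case True
      then show ?thesis using h assms edge_of_eq_iff by auto
    next
      case False
      then have "reach (T - {edge_of a}) h (\<alpha> h)" using h by (intro reach_alpha) auto
      then show ?thesis using h reach_trans by blast
    qed
  qed (use assms spanning_treeD in auto)
  moreover assume "\<not> reach (T - {edge_of a}) a y"
  ultimately show "reach (T - {edge_of a}) (\<alpha> a) y" by blast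
qed

text \<open>An excursion out of \<open>W\<close> is redundant: \<open>x\<close> is the only passage
  between \<open>W\<close> and its complement, so a path that leaves \<open>W\<close> through it
  returns to the same half-edge \<open>x\<close>.\<close>

lemma reach_confined:
  assumes "x \<in> H" "edge_of x \<notin> A" "reach (insert (edge_of x) A) c d"
    and "c \<in> H" "d \<in> H" "c \<in> W" "d \<in> W"
    and W: "\<And>h. h \<in> H \<Longrightarrow> \<sigma> h \<in> W \<longleftrightarrow> h \<in> W"
      "\<And>h. h \<in> H \<Longrightarrow> edge_of h \<in> A \<Longrightarrow> \<alpha> h \<in> W \<longleftrightarrow> h \<in> W"
    and x: "x \<in> W" "\<alpha> x \<notin> W"
  shows "reach A c d"
proof -
  \<comment> \<open>Outside \<open>W\<close> the invariant forgets the position and remembers only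
    that \<open>x\<close> was reached within \<open>A\<close>.\<close>
  let ?X = "{h \<in> W. reach A c h} \<union> {h. h \<notin> W \<and> reach A c x}"
  have "d \<in> ?X"
  proof (rule reach_closed[OF assms(3)])
    fix h assume h: "h \<in> H" "h \<in> ?X" "edge_of h \<in> insert (edge_of x) A"
    show "\<alpha> h \<in> ?X"
    proof (cases "edge_of h = edge_of x")
      case True
      then show ?thesis using h x \<open>x \<in> H\<close> by (auto simp: edge_of_eq_iff)
    next
      case False
      then have "edge_of h \<in> A" using h by auto
      then show ?thesis using h W(2)[of h] reach_trans[OF _ reach_alpha, of A c h] by auto
    qed
  qed (use assms in auto)
  then show ?thesis using assms by auto
qed

lemma reach_minus_closed:
  assumes "h \<in> H" "edge_of h \<in> A"
  shows "reach A c (\<alpha> h) \<longleftrightarrow> reach A c h"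
  using assms reach_alpha reach_sym reach_trans by meson

text \<open>Connectedness is regained across \<open>x\<close>. For a remaining tree edge
  \<open>c\<close>, a detour in the new set would have to leave the component of \<open>c\<close>
  through \<open>x\<close> and come back, so it shortens to a detour in \<open>T\<close>.\<close>

lemma exchange_if_crossing:
  assumes T: "spanning_tree T" and a: "a \<in> H" "edge_of a \<in> T" and x: "x \<in> H"
    and ax: "reach (T - {edge_of a}) a x" and bx: "reach (T - {edge_of a}) (\<alpha> a) (\<alpha> x)"
  shows "spanning_tree (insert (edge_of x) (T - {edge_of a}))"
proof -
  let ?A = "T - {edge_of a}"
  let ?T = "insert (edge_of x) ?A"
  have nab: "\<not> reach ?A a (\<alpha> a)" using spanning_treeD(3)[OF T a] .
  have xnA: "edge_of x \<notin> ?A"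
    using ax bx nab reach_minus_closed[of x ?A "\<alpha> a"] x reach_sym reach_trans by blast
  have xx: "reach ?T x (\<alpha> x)" using x by (intro reach_alpha) auto
  have up: "reach ?T y z" if "reach ?A y z" for y z using that by (rule reach_mono) auto
  have toa: "reach ?T a y" if "y \<in> H" for y
  proof (cases "reach ?A a y")
    case True
    then show ?thesis by (rule up)
  next
    case False
    then have "reach ?A (\<alpha> a) y" using split_by_bridge[OF T a that] by simp
    then show ?thesis using up[OF ax] xx up[OF bx] up reach_sym reach_trans by meson
  qed
  have "\<not> reach (?T - {edge_of c}) c (\<alpha> c)" if c: "c \<in> H" "edge_of c \<in> ?T" for c
  proof
    assume r: "reach (?T - {edge_of c}) c (\<alpha> c)"
    show False
    proof (cases "edge_of c = edge_of x")
      case True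
      then have "c = x \<or> c = \<alpha> x" using c x edge_of_eq_iff by blast
      moreover have "?T - {edge_of c} = ?A" using xnA True by auto
      ultimately have "reach ?A x (\<alpha> x)" using r x reach_sym by (metis alpha_involution)
      then show False
        using reach_trans[OF reach_trans[OF ax] reach_sym[OF bx]] nab by blast
    next
      case False
      let ?B = "?A - {edge_of c}"
      have eq: "?T - {edge_of c} = insert (edge_of x) ?B" using False by auto
      have cA: "edge_of c \<in> ?A" using c False by auto
      \<comment> \<open>\<open>s\<close> is the end of \<open>a\<close> on the side of
        \<open>c\<close>, and \<open>y\<close> the end of \<open>x\<close> on that same side; this
        treats both sides at once.\<close>
      define s where "s = (if reach ?A a c then a else \<alpha> a)"
      define y where "y = (if reach ?A a c then x else \<alpha> x)"
      let ?W = "{h. reach ?A s h}"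
      have y: "y \<in> H" "edge_of y = edge_of x" "\<alpha> (\<alpha> y) = y" "\<alpha> y \<in> H" using x by (auto simp: y_def)
      have sc: "reach ?A s c" using split_by_bridge[OF T a c(1)] by (auto simp: s_def)
      have sy: "reach ?A s y" using ax bx by (auto simp: s_def y_def)
      have nsy: "\<not> reach ?A s (\<alpha> y)"
        using ax bx nab x reach_sym reach_trans unfolding s_def y_def
        by (smt (verit) alpha_involution)
      have "reach ?B c (\<alpha> c)"
      proof (rule reach_confined[where W = ?W and x = y])
        show "reach (insert (edge_of y) ?B) c (\<alpha> c)" using r eq y by simp
        show "\<alpha> c \<in> ?W" using sc reach_minus_closed[OF c(1) cA] by auto
        show "edge_of y \<notin> ?B" using xnA y by auto
        show "\<alpha> h \<in> ?W \<longleftrightarrow> h \<in> ?W" if "h \<in> H" "edge_of h \<in> ?B" for h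
          using that reach_minus_closed[of h ?A s] by auto
      qed (use c sc sy nsy y in auto)
      then have "reach (T - {edge_of c}) c (\<alpha> c)" by (rule reach_mono) auto
      then show False using spanning_treeD(3)[OF T c(1)] cA by auto
    qed
  qed
  moreover have "?T \<subseteq> edges" using spanning_treeD(1)[OF T] x by auto
  moreover have "reach ?T y z" if "y \<in> H" "z \<in> H" for y z
    using reach_trans[OF reach_sym[OF toa] toa] that by simp
  ultimately show ?thesis unfolding spanning_tree_iff by simp
qed

lemma crossing_if_exchange:
  assumes T: "spanning_tree T" and a: "a \<in> H" "edge_of a \<in> T" and x: "x \<in> H"
    and ex: "spanning_tree (insert (edge_of x) (T - {edge_of a}))"
  shows "reach (T - {edge_of a}) (\<alpha> a) x \<noteq> reach (T - {edge_of a}) (\<alpha> a) (\<alpha> x)"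
proof
  let ?A = "T - {edge_of a}"
  assume eq: "reach ?A (\<alpha> a) x = reach ?A (\<alpha> a) (\<alpha> x)"
  have "a \<in> {h. reach ?A (\<alpha> a) h}"
  proof (rule reach_closed[OF spanning_treeD(2)[OF ex, of "\<alpha> a" a]])
    fix h assume h: "h \<in> H" "h \<in> {h. reach ?A (\<alpha> a) h}" "edge_of h \<in> insert (edge_of x) ?A"
    show "\<alpha> h \<in> {h. reach ?A (\<alpha> a) h}"
    proof (cases "edge_of h = edge_of x")
      case True
      then show ?thesis using h x eq by (auto simp: edge_of_eq_iff)
    next
      case False
      then show ?thesis using h reach_minus_closed[of h ?A "\<alpha> a"] by auto
    qed
  qed (use a in auto)
  then show False using spanning_treeD(3)[OF T a] reach_sym by blast
qed

lemma exchange_iff: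
  assumes T: "spanning_tree T" and a: "a \<in> H" "edge_of a \<in> T" and x: "x \<in> H"
  shows "spanning_tree (insert (edge_of x) (T - {edge_of a})) \<longleftrightarrow>
    reach (T - {edge_of a}) (\<alpha> a) x \<noteq> reach (T - {edge_of a}) (\<alpha> a) (\<alpha> x)"
proof
  assume ne: "reach (T - {edge_of a}) (\<alpha> a) x \<noteq> reach (T - {edge_of a}) (\<alpha> a) (\<alpha> x)"
  note s = split_by_bridge[OF T a]
  show "spanning_tree (insert (edge_of x) (T - {edge_of a}))"
  proof (cases "reach (T - {edge_of a}) (\<alpha> a) x")
    case True
    then have "reach (T - {edge_of a}) a (\<alpha> x)" using ne s[of "\<alpha> x"] x by simp
    then show ?thesis
      using exchange_if_crossing[OF T a, of "\<alpha> x"] True x by simp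
  next
    case False
    then show ?thesis using exchange_if_crossing[OF T a x] ne s[OF x] by simp
  qed
qed (rule crossing_if_exchange[OF assms])

text \<open>Settles the case in the definition of the fundamental cycle where the edge to be removed
  does not lie in \<open>T\<close> with the external edge added.\<close>

lemma insert_not_spanning_tree:
  assumes "spanning_tree T" "x \<in> H" "edge_of x \<notin> T"
  shows "\<not> spanning_tree (insert (edge_of x) T)"
proof
  assume "spanning_tree (insert (edge_of x) T)"
  from spanning_treeD(3)[OF this assms(2)] have "\<not> reach T x (\<alpha> x)" using assms by simp
  then show False using spanning_treeD(2)[OF assms(1)] assms(2) by simp
qed

text \<open>The minimal \<open>Q \<subseteq> T\<close> connecting \<open>x\<close> to \<open>y\<close> is the path of \<open>T\<close> from \<open>x\<close> to \<open>y\<close>, and \<open>c\<close> is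
  the half-edge through which it first leaves \<open>X\<close>.\<close>

lemma path_leaves_set:
  assumes T: "spanning_tree T" and xy: "x \<in> H" "y \<in> H" "x \<in> X" "y \<notin> X"
    and X: "\<And>h. h \<in> H \<Longrightarrow> h \<in> X \<Longrightarrow> \<sigma> h \<in> X"
  obtains c where "c \<in> H" "c \<in> X" "\<alpha> c \<notin> X" "edge_of c \<in> T"
    "reach (T - {edge_of c}) x c" "reach (T - {edge_of c}) (\<alpha> c) y"
proof -
  let ?P = "\<lambda>Q. Q \<subseteq> T \<and> reach Q x y"
  have "?P T" using spanning_treeD(2)[OF T] xy by simp
  then obtain Q where Q: "?P Q" and min: "\<And>Q'. ?P Q' \<Longrightarrow> card Q \<le> card Q'"
    using ex_has_least_nat[of ?P T card] by blast
  have finQ: "finite Q"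
    using Q spanning_treeD(1)[OF T] finite_edges by (meson finite_subset)
  \<comment> \<open>\<open>?Q\<close> consists of the edges of the path with both half-edges in
    \<open>X\<close>, so \<open>?Z\<close> is what the path reaches before it first leaves
    \<open>X\<close>.\<close>
  let ?Q = "{e \<in> Q. e \<subseteq> X}"
  let ?Z = "{h \<in> X. reach ?Q x h}"
  have "\<exists>c \<in> H. c \<in> ?Z \<and> edge_of c \<in> Q \<and> \<alpha> c \<notin> ?Z"
  proof (rule ccontr)
    assume "\<not> ?thesis"
    then have "y \<in> ?Z" using reach_closed[of Q x y ?Z] Q xy X by auto
    then show False using xy by simp
  qed
  then obtain c where c: "c \<in> H" "c \<in> X" "reach ?Q x c" "edge_of c \<in> Q" "\<alpha> c \<notin> ?Z" by blast
  have acX: "\<alpha> c \<notin> X"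
  proof
    assume "\<alpha> c \<in> X"
    then have "edge_of c \<in> ?Q" using c by (auto simp: edge_of_def)
    then have "reach ?Q x (\<alpha> c)" using c reach_minus_closed[of c ?Q x] by simp
    then show False using c \<open>\<alpha> c \<in> X\<close> by blast
  qed
  have "?Q \<subseteq> Q - {edge_of c}" using acX by (auto simp: edge_of_def)
  then have xc: "reach (Q - {edge_of c}) x c" using c reach_mono by blast
  have nxy: "\<not> reach (Q - {edge_of c}) x y"
    using min[of "Q - {edge_of c}"] Q card_Diff1_less[OF finQ c(4)] by auto
  let ?Y = "{h. reach (Q - {edge_of c}) x h \<or> reach (Q - {edge_of c}) (\<alpha> c) h}"
  have "y \<in> ?Y"
  proof (rule reach_closed[of Q x y])
    fix h assume h: "h \<in> H" "h \<in> ?Y" "edge_of h \<in> Q"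
    show "\<alpha> h \<in> ?Y"
    proof (cases "edge_of h = edge_of c")
      case True
      then show ?thesis using h c xc by (auto simp: edge_of_eq_iff)
    next
      case False
      then show ?thesis using h reach_minus_closed[of h "Q - {edge_of c}"] by auto
    qed
  qed (use Q xy in auto)
  then have "reach (Q - {edge_of c}) (\<alpha> c) y" using nxy by blast
  moreover have "Q - {edge_of c} \<subseteq> T - {edge_of c}" using Q by auto
  ultimately show ?thesis using that[OF c(1,2) acX] xc Q c reach_mono by blast
qed

section \<open>The motion function as a cyclic permutation\<close>

lemma motion_permutes:
  assumes "F \<subseteq> edges"
  shows "motion F permutes H"
proof (rule bij_imp_permutes)
  have "inj_on (motion F) H"
  proof (rule inj_onI)
    fix x y assume xy: "x \<in> H" "y \<in> H" "motion F x = motion F y"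
    have si: "\<sigma> u = \<sigma> v \<longleftrightarrow> u = v" for u v using sigma_permutes permutes_inj injD by metis
    show "x = y"
    proof (cases "edge_of x \<in> F \<longleftrightarrow> edge_of y \<in> F")
      case True
      then have "x = y \<or> \<alpha> x = \<alpha> y" using xy si by (auto simp: motion_def split: if_splits)
      then show ?thesis using xy alpha_involution by metis
    next
      case False
      then have "x = \<alpha> y \<or> y = \<alpha> x" using xy si by (auto simp: motion_def split: if_splits)
      then have "edge_of x = edge_of y" using xy by auto
      then show ?thesis using False by simp
    qed
  qed
  moreover have "motion F ` H \<subseteq> H" by (auto simp: motion_def)
  ultimately show "bij_betw (motion F) H H"
    using finite_H by (simp add: bij_betw_def endo_inj_surj)
next
  fix h assume h: "h \<notin> H"
  have "edge_of h \<notin> F"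
  proof
    assume "edge_of h \<in> F"
    then obtain g where "g \<in> H" "edge_of h = edge_of g" using assms by (meson edgesE subsetD)
    then show False using h by (auto simp: edge_of_def doubleton_eq_iff)
  qed
  then show "motion F h = h" using h sigma_permutes by (simp add: motion_def permutes_not_in)
qed

lemma permutation_motion: "F \<subseteq> edges \<Longrightarrow> permutation (motion F)"
  using motion_permutes finite_H permutes_imp_permutation by blast

lemma motion_in_H [simp]: "h \<in> H \<Longrightarrow> motion F h \<in> H"
  by (simp add: motion_def)

lemma reach_motion: "h \<in> H \<Longrightarrow> reach F h (motion F h)"
  by (simp add: motion_def reach_alpha)

lemma orbit_motion_reach: "y \<in> orbit (motion F) x \<Longrightarrow> x \<in> H \<Longrightarrow> y \<in> H \<and> reach F x y"
  by (induction rule: orbit.induct) (use reach_motion reach_trans in auto)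

text \<open>Inserting an edge between two components composes the motion function with a transposition,
  which merges the two corresponding cycles.\<close>

lemma orbit_motion_forest:
  assumes "finite F"
  shows "F \<subseteq> edges \<Longrightarrow> acyclic_subgraph F \<Longrightarrow> x \<in> H \<Longrightarrow> y \<in> H \<Longrightarrow> reach F x y \<Longrightarrow>
    y \<in> orbit (motion F) x"
  using assms
proof (induction F arbitrary: x y rule: finite_induct)
  case empty
  have "motion {} = \<sigma>" by (simp add: motion_def fun_eq_iff)
  moreover have "y \<in> orbit \<sigma> x"
    using reach_closed[OF empty(5), of "orbit \<sigma> x"] empty(3,4) in_vertex_of[of x]
    by (auto simp: vertex_of_def intro: orbit.step)
  ultimately show ?case by simp
next
  case (insert e F)
  let ?f = "motion F" and ?p = "motion (insert e F)"
  obtain a where a: "a \<in> H" "e = edge_of a" using insert.prems by (auto elim: edgesE)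
  let ?b = "\<alpha> a"
  have nab: "\<not> reach F a ?b"
    using insert.prems(2) insert.hyps a by (auto simp: acyclic_subgraph_iff)
  have acF: "acyclic_subgraph F" using insert.prems(2) by (auto simp: acyclic_subgraph_def)
  have perm: "permutation ?f" "permutation ?p"
    using permutation_motion insert.prems by auto
  have self: "z \<in> orbit ?p z" for z by (rule permutation_self_in_orbit[OF perm(2)])
  have sy: "z \<in> orbit ?p w \<Longrightarrow> w \<in> orbit ?p z" for z w by (rule orbit_swap[OF self])
  have same: "?p h = ?f h" if "h \<in> H" "h \<noteq> a" "h \<noteq> ?b" for h
    using that a edge_of_eq_iff by (auto simp: motion_def)
  have pa: "?p a = ?f ?b" and pb: "?p ?b = ?f a"
    using a insert.hyps by (auto simp: motion_def)
  \<comment> \<open>From \<open>?f ?b\<close> on, the new motion copies the old cycle of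
    \<open>?b\<close> until it returns to \<open>?b\<close>: the only other place where the two
    motions differ is \<open>a\<close>, which lies in another component of \<open>F\<close>.\<close>
  have run: "?b \<in> orbit ?p (?f ?b)"
  proof -
    have main: "z \<in> orbit ?p (?f ?b) \<or> ?b \<in> orbit ?p (?f ?b)" if "z \<in> orbit ?f ?b" for z
      using that
    proof (induction rule: orbit.induct)
      case base
      then show ?case using self by blast
    next
      case (step z)
      have z: "z \<in> H" "reach F ?b z" using orbit_motion_reach[OF step.hyps] a by auto
      then have "z \<noteq> a" using nab reach_sym by blast
      then show ?case using step.IH same[OF z(1)] orbit.step by metis
    qed
    show ?thesis using main[OF permutation_self_in_orbit[OF perm(1)]] by simp
  qed
  then have ab: "?b \<in> orbit ?p a" using pa orbit_trans orbit.base by metis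
  have fstep: "?f h \<in> orbit ?p h" if "h \<in> H" for h
  proof -
    consider "h = a" | "h = ?b" | "h \<noteq> a" "h \<noteq> ?b" by blast
    then show ?thesis
    proof cases
      case 1
      then show ?thesis using ab pb orbit.step by metis
    next
      case 2
      then show ?thesis using sy[OF run] by simp
    next
      case 3
      then show ?thesis using same[OF that 3] orbit.base by metis
    qed
  qed
  have forb: "z \<in> orbit ?p w" if "z \<in> orbit ?f w" "w \<in> H" for z w
    using that
  proof (induction rule: orbit.induct)
    case (step z)
    then show ?case using fstep orbit_motion_reach orbit_trans by metis
  qed (use fstep in auto)
  have IH: "z \<in> orbit ?p w" if "w \<in> H" "z \<in> H" "reach F w z" for w z
    using insert.IH[OF _ acF that] insert.prems forb that by auto
  have "y \<in> orbit ?p x \<inter> H"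
  proof (rule reach_closed[OF insert.prems(5)])
    fix h assume h: "h \<in> H" "h \<in> orbit ?p x \<inter> H"
    show "\<sigma> h \<in> orbit ?p x \<inter> H" using IH[of h "\<sigma> h"] h orbit_trans[of "\<sigma> h" ?p h x] by auto
    assume e: "edge_of h \<in> insert e F"
    have "\<alpha> h \<in> orbit ?p h"
    proof (cases "edge_of h = e")
      case True
      then show ?thesis using a h ab sy by (auto simp: edge_of_eq_iff)
    next
      case False
      then show ?thesis using e h IH reach_alpha by auto
    qed
    then show "\<alpha> h \<in> orbit ?p x \<inter> H" using h orbit_trans by (metis IntD1 IntI alpha_in_H)
  qed (use insert.prems self in auto)
  then show ?case by blast
qed

subsection \<open>The tour of a spanning tree\<close>

abbreviation tour :: "'h set set \<Rightarrow> nat \<Rightarrow> 'h" where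
  "tour T n \<equiv> (motion T ^^ n) h0"

abbreviation rank :: "'h set set \<Rightarrow> 'h \<Rightarrow> nat" where
  "rank \<equiv> half_edge_rank"

lemma tour_in_H [simp]: "tour T n \<in> H"
  by (induction n) (auto simp: root_in_H)

lemma tour_rank:
  assumes T: "spanning_tree T" and h: "h \<in> H"
  shows "tour T (rank T h) = h"
proof -
  have "finite T" "acyclic_subgraph T"
    using T finite_edges finite_subset unfolding spanning_tree_def subgraphs_def by auto
  then have "h \<in> orbit (motion T) h0"
    using orbit_motion_forest[of T h0 h] spanning_treeD[OF T] h root_in_H by blast
  then have "\<exists>n. tour T n = h" by (auto simp: orbit_altdef)
  then show ?thesis unfolding half_edge_rank_def by (rule LeastI_ex)
qed

lemma rank_le: "tour T n = h \<Longrightarrow> rank T h \<le> n"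
  unfolding half_edge_rank_def by (rule Least_le)

lemma rank_eq_iff: "spanning_tree T \<Longrightarrow> x \<in> H \<Longrightarrow> y \<in> H \<Longrightarrow> rank T x = rank T y \<longleftrightarrow> x = y"
  by (metis tour_rank)

text \<open>No half-edge repeats on the tour before \<open>h\<close> is reached: an earlier visit of
  \<open>tour T i\<close> would let the tour reach \<open>h\<close> that much sooner, below its
  rank.\<close>

lemma rank_tour:
  assumes T: "spanning_tree T" and h: "h \<in> H" and i: "i \<le> rank T h"
  shows "rank T (tour T i) = i"
proof -
  let ?j = "rank T (tour T i)" and ?r = "rank T h"
  have j: "?j \<le> i" "tour T ?j = tour T i" using rank_le tour_rank[OF T] by auto
  have "tour T (?r - i + ?j) = (motion T ^^ (?r - i)) (tour T ?j)" by (simp add: funpow_add)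
  also have "\<dots> = (motion T ^^ (?r - i)) (tour T i)" by (simp only: j)
  also have "\<dots> = tour T (?r - i + i)" by (simp add: funpow_add)
  also have "\<dots> = h" using i tour_rank[OF T h] by simp
  finally have "?r \<le> ?r - i + ?j" by (rule rank_le)
  then show ?thesis using i j by linarith
qed

lemma rank_less_card:
  assumes T: "spanning_tree T" and h: "h \<in> H"
  shows "rank T h < card H"
proof -
  have "inj_on (tour T) {..rank T h}"
    by (rule inj_on_inverseI[of _ "rank T"]) (use rank_tour[OF T h] in auto)
  then have "card {..rank T h} \<le> card H"
    by (rule card_inj_on_le) (auto simp: finite_H)
  then show ?thesis by simp
qed

section \<open>Cuts of a tree as intervals of its tour\<close>

definition low :: "'h set set \<Rightarrow> 'h \<Rightarrow> bool" where
  "low T a \<longleftrightarrow> a \<in> H \<and> rank T a < rank T (\<alpha> a)"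

text \<open>Half-open on purpose. The tour moves from an internal low \<open>a\<close> to
  \<open>\<sigma> (\<alpha> a)\<close>, at the far vertex, and visits \<open>\<alpha> a\<close> last
  before coming back, so \<open>a\<close> is excluded and \<open>\<alpha> a\<close>
  included.\<close>

definition below :: "'h set set \<Rightarrow> 'h \<Rightarrow> 'h set" where
  "below T a = {h \<in> H. rank T a < rank T h \<and> rank T h \<le> rank T (\<alpha> a)}"

text \<open>One relation for both fundamental structures: for internal low \<open>a\<close> it puts
  the edge of \<open>x\<close> in the cocycle of \<open>a\<close>, and for external \<open>x\<close>
  it puts the edge of \<open>a\<close> in the cycle of \<open>x\<close>.\<close>

definition crosses :: "'h set set \<Rightarrow> 'h \<Rightarrow> 'h \<Rightarrow> bool" where
  "crosses T a x \<longleftrightarrow> (x \<in> below T a \<longleftrightarrow> \<alpha> x \<notin> below T a)"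

lemma lowD: "low T a \<Longrightarrow> a \<in> H" "low T a \<Longrightarrow> rank T a < rank T (\<alpha> a)"
  by (auto simp: low_def)

lemma low_alpha: "spanning_tree T \<Longrightarrow> x \<in> H \<Longrightarrow> low T (\<alpha> x) \<longleftrightarrow> \<not> low T x"
  using rank_eq_iff[of T x "\<alpha> x"] alpha_no_fixpoint[of x] by (auto simp: low_def)

lemma low_unique: "low T x \<Longrightarrow> low T y \<Longrightarrow> edge_of x = edge_of y \<Longrightarrow> x = y"
  by (auto simp: low_def edge_of_eq_iff)

lemma obtain_low:
  assumes "spanning_tree T" "e \<in> edges"
  obtains a where "low T a" "e = edge_of a"
proof -
  obtain x where "x \<in> H" "e = edge_of x" using assms by (auto elim: edgesE)
  then show ?thesis using that[of x] that[of "\<alpha> x"] low_alpha[OF assms(1), of x] by auto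
qed

text \<open>The part of the tree beyond an internal edge is toured in one go, so the half-edges on that
  side form an interval of the order.\<close>

lemma below_iff_reach:
  assumes T: "spanning_tree T" and a: "low T a" "edge_of a \<in> T" and h: "h \<in> H"
  shows "h \<in> below T a \<longleftrightarrow> reach (T - {edge_of a}) (\<alpha> a) h"
proof -
  let ?A = "T - {edge_of a}" and ?b = "\<alpha> a"
  let ?U = "{h. reach ?A ?b h}"
  have aH: "a \<in> H" "rank T a < rank T ?b" using a by (auto simp: low_def)
  have aU: "a \<notin> ?U" using spanning_treeD(3)[OF T aH(1) a(2)] reach_sym by blast
  \<comment> \<open>The tour changes sides only when it stands at \<open>a\<close> or at
    \<open>\<alpha> a\<close>; hence the three stretches \<open>early\<close>, \<open>mid\<close>
    and \<open>late\<close>.\<close>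
  have step: "motion T x \<in> ?U \<longleftrightarrow> x \<in> ?U" if "x \<in> H" "x \<noteq> a" "x \<noteq> ?b" for x
  proof (cases "edge_of x \<in> T")
    case True
    then have "edge_of x \<in> ?A" using that aH edge_of_eq_iff by auto
    then show ?thesis using True reach_minus_closed[OF that(1)] by (simp add: motion_def)
  qed (simp add: motion_def)
  have sa: "motion T a \<in> ?U" using a by (simp add: motion_def)
  have sb: "motion T ?b \<notin> ?U" using a aH aU by (simp add: motion_def)
  have ne: "tour T i \<noteq> x" if "x \<in> H" "i \<noteq> rank T x" "i \<le> rank T y" "y \<in> H" for i x y
    using rank_tour[OF T that(4,3)] that by auto
  \<comment> \<open>A tour starting beyond \<open>a\<close> could change sides only at
    \<open>a\<close> or \<open>\<alpha> a\<close>. Since \<open>a\<close> comes before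
    \<open>\<alpha> a\<close>, it would still be beyond when it stands at \<open>a\<close>, which is
    absurd.\<close>
  have h0U: "h0 \<notin> ?U"
  proof
    assume "h0 \<in> ?U"
    have "i \<le> rank T a \<Longrightarrow> tour T i \<in> ?U" for i
    proof (induction i)
      case (Suc i)
      then show ?case
        using step[of "tour T i"] ne[of a i a] ne[of ?b i a] aH by simp
    qed (use \<open>h0 \<in> ?U\<close> in simp)
    from this[of "rank T a"] show False using aU tour_rank[OF T aH(1)] by simp
  qed
  have early: "i \<le> rank T a \<Longrightarrow> tour T i \<notin> ?U" for i
  proof (induction i)
    case (Suc i)
    then show ?case using step[of "tour T i"] ne[of a i a] ne[of ?b i a] aH by simp
  qed (use h0U in simp)
  have mid: "rank T a + Suc i \<le> rank T ?b \<Longrightarrow> tour T (rank T a + Suc i) \<in> ?U" for i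
  proof (induction i)
    case 0
    then show ?case using sa tour_rank[OF T aH(1)] by simp
  next
    case (Suc i)
    then show ?case
      using step[of "tour T (rank T a + Suc i)"] ne[of a "rank T a + Suc i" ?b]
        ne[of ?b "rank T a + Suc i" ?b] aH by simp
  qed
  have late: "rank T ?b + Suc i \<le> rank T h \<Longrightarrow> tour T (rank T ?b + Suc i) \<notin> ?U" for i
  proof (induction i)
    case 0
    then show ?case using sb tour_rank[OF T, of ?b] aH by simp
  next
    case (Suc i)
    then show ?case
      using step[of "tour T (rank T ?b + Suc i)"] ne[of a "rank T ?b + Suc i" h]
        ne[of ?b "rank T ?b + Suc i" h] aH h by simp
  qed
  have th: "tour T (rank T h) = h" using tour_rank[OF T h] .
  consider "rank T h \<le> rank T a" | "rank T a < rank T h" "rank T h \<le> rank T ?b"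
    | "rank T ?b < rank T h" by linarith
  then show ?thesis
  proof cases
    case 1
    then show ?thesis using early[of "rank T h"] th
      by (auto simp: below_def)
  next
    case 2
    then obtain i where "rank T h = rank T a + Suc i" using less_imp_Suc_add by fastforce
    then have "h \<in> ?U"
      using mid[of i] 2 th by simp
    then show ?thesis using 2 h by (simp add: below_def)
  next
    case 3
    then obtain i where "rank T h = rank T ?b + Suc i" using less_imp_Suc_add by fastforce
    then have "h \<notin> ?U"
      using late[of i] th by simp
    then show ?thesis using 3 h by (simp add: below_def)
  qed
qed

lemma below_sigma:
  assumes "spanning_tree T" "low T a" "edge_of a \<in> T" "h \<in> H"
  shows "\<sigma> h \<in> below T a \<longleftrightarrow> h \<in> below T a"
  using below_iff_reach[OF assms] below_iff_reach[OF assms(1-3), of "\<sigma> h"] assms(4) by simp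

lemma internal_not_crosses:
  assumes "spanning_tree T" "low T a" "edge_of a \<in> T" "x \<in> H" "edge_of x \<in> T" "edge_of x \<noteq> edge_of a"
  shows "\<not> crosses T a x"
  unfolding crosses_def
  using below_iff_reach[OF assms(1-4)] below_iff_reach[OF assms(1-3), of "\<alpha> x"]
    reach_minus_closed[OF assms(4), of "T - {edge_of a}"] assms(4-6) by simp

lemma crosses_self: "low T a \<Longrightarrow> crosses T a a"
  by (simp add: crosses_def low_def below_def)

lemma crosses_alpha: "x \<in> H \<Longrightarrow> crosses T a (\<alpha> x) \<longleftrightarrow> crosses T a x"
  by (auto simp: crosses_def)

lemma exchange_iff_crosses:
  assumes "spanning_tree T" "low T a" "edge_of a \<in> T" "x \<in> H"
  shows "spanning_tree (insert (edge_of x) (T - {edge_of a})) \<longleftrightarrow> crosses T a x"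
  using exchange_iff[of T a x] below_iff_reach[OF assms] below_iff_reach[OF assms(1-3), of "\<alpha> x"]
    assms lowD(1)[OF assms(2)] by (auto simp: crosses_def)

lemma fundamental_cocycle_iff:
  assumes "spanning_tree T" "low T a" "edge_of a \<in> T" "x \<in> H"
  shows "edge_of x \<in> fundamental_cocycle T (edge_of a) \<longleftrightarrow> crosses T a x"
  using exchange_iff_crosses[OF assms] assms(4) by (simp add: fundamental_cocycle_def)

text \<open>The external edge lies in its own cycle because exchanging it for itself gives
  \<open>T\<close>. For a tree edge \<open>x\<close> the condition is an exchange across the cut of
  \<open>x\<close>. Removing any other edge leaves \<open>T\<close> with one extra edge, which is no
  tree.\<close>

lemma fundamental_cycle_iff:
  assumes T: "spanning_tree T" and g: "g \<in> H" "edge_of g \<notin> T" and x: "low T x"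
  shows "edge_of x \<in> fundamental_cycle T (edge_of g) \<longleftrightarrow>
    edge_of x = edge_of g \<or> edge_of x \<in> T \<and> crosses T x g"
proof -
  have xH: "x \<in> H" using x by (rule lowD)
  have mem: "edge_of x \<in> fundamental_cycle T (edge_of g) \<longleftrightarrow>
      spanning_tree (insert (edge_of g) T - {edge_of x})"
    using xH by (simp add: fundamental_cycle_def)
  consider "edge_of x = edge_of g" | "edge_of x \<in> T" "edge_of x \<noteq> edge_of g"
    | "edge_of x \<notin> T" "edge_of x \<noteq> edge_of g" by blast
  then show ?thesis
  proof cases
    case 1
    then show ?thesis using mem T g by simp
  next
    case 2
    then have "insert (edge_of g) T - {edge_of x} = insert (edge_of g) (T - {edge_of x})" by auto
    then show ?thesis using mem exchange_iff_crosses[OF T x 2(1) g(1)] 2 by simp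
  next
    case 3
    then have "insert (edge_of g) T - {edge_of x} = insert (edge_of g) T" by auto
    then show ?thesis using mem insert_not_spanning_tree[OF T g] 3 by simp
  qed
qed

text \<open>\<open>c\<close> lies on the tree path from \<open>x\<close> to \<open>y\<close>. If
  \<open>c\<close> is low, the path moves away from the root there; if \<open>\<alpha> c\<close> is
  low, it moves towards the root. Exactly one of these holds.\<close>

lemma tree_path_leaves_set:
  assumes T: "spanning_tree T" and xy: "x \<in> H" "y \<in> H" "x \<in> X" "y \<notin> X"
    and X: "\<And>h. h \<in> H \<Longrightarrow> h \<in> X \<Longrightarrow> \<sigma> h \<in> X"
  obtains c where "c \<in> H" "c \<in> X" "\<alpha> c \<notin> X" "edge_of c \<in> T"
    "low T c \<Longrightarrow> x \<notin> below T c \<and> y \<in> below T c"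
    "low T (\<alpha> c) \<Longrightarrow> x \<in> below T (\<alpha> c) \<and> y \<notin> below T (\<alpha> c)"
proof -
  obtain c where c: "c \<in> H" "c \<in> X" "\<alpha> c \<notin> X" "edge_of c \<in> T"
    and r: "reach (T - {edge_of c}) x c" "reach (T - {edge_of c}) (\<alpha> c) y"
    using path_leaves_set[OF assms] by blast
  have x: "\<not> reach (T - {edge_of c}) (\<alpha> c) x"
    using split_by_bridge[OF T c(1,4) xy(1)] reach_sym[OF r(1)] by simp
  have y: "\<not> reach (T - {edge_of c}) c y"
    using split_by_bridge[OF T c(1,4) xy(2)] r(2) by simp
  show ?thesis
  proof (rule that[OF c])
    assume "low T c"
    then show "x \<notin> below T c \<and> y \<in> below T c"
      using below_iff_reach[OF T _ c(4)] xy x r by simp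
  next
    assume "low T (\<alpha> c)"
    then show "x \<in> below T (\<alpha> c) \<and> y \<notin> below T (\<alpha> c)"
      using below_iff_reach[OF T, of "\<alpha> c"] c xy y r reach_sym by simp
  qed
qed

lemma smaller_half_edge_low:
  assumes "low T a"
  shows "smaller_half_edge T (edge_of a) = a"
  unfolding smaller_half_edge_def
proof (rule the_equality)
  show "a \<in> edge_of a \<and> half_edge_less T a (\<alpha> a)"
    using assms by (simp add: edge_of_def half_edge_less_def low_def)
  fix h assume "h \<in> edge_of a \<and> half_edge_less T h (\<alpha> h)"
  then show "h = a" using assms by (auto simp: edge_of_def half_edge_less_def low_def)
qed

lemma edge_less_low: "low T a \<Longrightarrow> low T b \<Longrightarrow> edge_less T (edge_of a) (edge_of b) \<longleftrightarrow> rank T a < rank T b"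
  by (simp add: edge_less_def smaller_half_edge_low half_edge_less_def)

lemma internal_active_iff:
  assumes T: "spanning_tree T" and a: "low T a" "edge_of a \<in> T"
  shows "edge_of a \<in> internal_active T \<longleftrightarrow> (\<forall>x. low T x \<longrightarrow> crosses T a x \<longrightarrow> rank T a \<le> rank T x)"
proof -
  have "edge_of a \<in> internal_active T \<longleftrightarrow>
      (\<forall>e' \<in> fundamental_cocycle T (edge_of a). \<not> edge_less T e' (edge_of a))"
    using a by (auto simp: internal_active_def)
  also have "\<dots> \<longleftrightarrow> (\<forall>x. low T x \<longrightarrow> edge_of x \<in> fundamental_cocycle T (edge_of a) \<longrightarrow>
      \<not> edge_less T (edge_of x) (edge_of a))"
  proof -
    have "\<exists>x. low T x \<and> e' = edge_of x" if "e' \<in> fundamental_cocycle T (edge_of a)" for e'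
      using that obtain_low[OF T, of e'] by (auto simp: fundamental_cocycle_def)
    then show ?thesis by blast
  qed
  also have "\<dots> \<longleftrightarrow> (\<forall>x. low T x \<longrightarrow> crosses T a x \<longrightarrow> rank T a \<le> rank T x)"
    using fundamental_cocycle_iff[OF T a] edge_less_low[OF _ a(1)] lowD(1) by (meson not_less)
  finally show ?thesis .
qed

lemma external_active_iff:
  assumes T: "spanning_tree T" and g: "low T g" "edge_of g \<notin> T"
  shows "edge_of g \<in> external_active T \<longleftrightarrow>
    (\<forall>a. low T a \<longrightarrow> edge_of a \<in> T \<longrightarrow> crosses T a g \<longrightarrow> rank T g \<le> rank T a)"
proof -
  have gH: "g \<in> H" using g lowD by blast
  have "edge_of g \<in> external_active T \<longleftrightarrow>
      (\<forall>e' \<in> fundamental_cycle T (edge_of g). \<not> edge_less T e' (edge_of g))"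
    using g gH by (auto simp: external_active_def)
  also have "\<dots> \<longleftrightarrow> (\<forall>x. low T x \<longrightarrow> edge_of x \<in> fundamental_cycle T (edge_of g) \<longrightarrow>
      \<not> edge_less T (edge_of x) (edge_of g))"
  proof -
    have "\<exists>x. low T x \<and> e' = edge_of x" if "e' \<in> fundamental_cycle T (edge_of g)" for e'
      using that obtain_low[OF T, of e'] by (auto simp: fundamental_cycle_def)
    then show ?thesis by blast
  qed
  also have "\<dots> \<longleftrightarrow> (\<forall>a. low T a \<longrightarrow> edge_of a \<in> T \<longrightarrow> crosses T a g \<longrightarrow> rank T g \<le> rank T a)"
    using fundamental_cycle_iff[OF T gH g(2)] edge_less_low[OF _ g(1)] low_unique[OF _ g(1)]
    by (metis less_irrefl not_less)
  finally show ?thesis .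
qed

section \<open>The first difference of two spanning trees\<close>

lemma tours_agree:
  assumes "\<And>i. i < n \<Longrightarrow> edge_of (tour T i) \<in> T \<longleftrightarrow> edge_of (tour T i) \<in> T'" and "i \<le> n"
  shows "tour T' i = tour T i"
  using assms(2)
proof (induction i)
  case (Suc i)
  then show ?case using assms(1)[of i] by (simp add: motion_def[of _ "tour T i"])
qed simp

text \<open>Not symmetric: \<open>h\<close> is internal in \<open>T\<close> and external in
  \<open>T'\<close>. The last clause accepts an early rank in either tour, so that being early in
  one order already forces the same rank and status in both.\<close>

definition diverge :: "'h set set \<Rightarrow> 'h set set \<Rightarrow> 'h \<Rightarrow> bool" where
  "diverge T T' h \<longleftrightarrow> low T h \<and> low T' h \<and> rank T' h = rank T h \<and> edge_of h \<in> T \<and> edge_of h \<notin> T' \<and>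
     (\<forall>x \<in> H. rank T x < rank T h \<or> rank T' x < rank T h \<longrightarrow>
        rank T' x = rank T x \<and> (edge_of x \<in> T \<longleftrightarrow> edge_of x \<in> T'))"

text \<open>Both tours run identically up to the first place \<open>n\<close> where the visited edge
  has different status in the two trees. The half-edge there is low in both: meeting its partner
  sooner would have been an earlier difference.\<close>

lemma first_difference:
  assumes T: "spanning_tree T" and T': "spanning_tree T'" and ne: "T \<noteq> T'"
  obtains h where "diverge T T' h \<or> diverge T' T h"
proof -
  let ?d = "\<lambda>i. edge_of (tour T i) \<in> T \<longleftrightarrow> edge_of (tour T i) \<notin> T'"
  obtain e where e: "e \<in> T \<longleftrightarrow> e \<notin> T'" using ne by blast
  then have "e \<in> edges" using T T' spanning_treeD(1) by blast
  then obtain x where "x \<in> H" "e = edge_of x" by (rule edgesE)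
  then have "?d (rank T x)" using e tour_rank[OF T] by simp
  then have ex: "\<exists>i. ?d i" by blast
  define n where "n = (LEAST i. ?d i)"
  have dn: "?d n" unfolding n_def using ex by (rule LeastI_ex)
  have lt: "\<not> ?d i" if "i < n" for i using that not_less_Least unfolding n_def by blast
  have ag: "tour T' i = tour T i" if "i \<le> n" for i
    using tours_agree[of n T T' i] lt that by blast
  have vis: "rank T x = rank T' x \<and> (edge_of x \<in> T \<longleftrightarrow> edge_of x \<in> T')"
    if "x \<in> H" "rank T x < n \<or> rank T' x < n" for x
  proof -
    have "rank T x \<le> n \<Longrightarrow> rank T' x \<le> rank T x" "rank T' x \<le> n \<Longrightarrow> rank T x \<le> rank T' x"
      using rank_le tour_rank that(1) T T' ag by metis+
    then have eq: "rank T x = rank T' x" using that(2) by linarith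
    then show ?thesis using lt[of "rank T x"] that tour_rank[OF T that(1)] by auto
  qed
  let ?h = "tour T n"
  have nv: "n \<le> rank T y \<and> n \<le> rank T' y" if "y \<in> H" "edge_of y = edge_of ?h" for y
  proof -
    have "\<not> (edge_of y \<in> T \<longleftrightarrow> edge_of y \<in> T')" using dn that(2) by simp
    then have "\<not> (rank T y < n \<or> rank T' y < n)" using vis[OF that(1)] by blast
    then show ?thesis by simp
  qed
  have r: "rank T ?h = n" "rank T' ?h = n"
    using nv[of ?h] rank_le[of n T ?h] rank_le[of n T' ?h] ag[of n] by auto
  moreover have "rank T (\<alpha> ?h) \<noteq> n" "rank T' (\<alpha> ?h) \<noteq> n"
    using r rank_eq_iff[OF T, of ?h "\<alpha> ?h"] rank_eq_iff[OF T', of ?h "\<alpha> ?h"]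
      alpha_no_fixpoint[of ?h] by auto
  ultimately have "low T ?h" "low T' ?h" using nv[of "\<alpha> ?h"] by (auto simp: low_def)
  then have "diverge T T' ?h \<or> diverge T' T ?h"
    using r dn vis unfolding diverge_def by metis
  then show ?thesis by (rule that)
qed

lemma divergeD:
  assumes "diverge T T' h"
  shows "low T h" "low T' h" "rank T' h = rank T h" "edge_of h \<in> T" "edge_of h \<notin> T'"
    "x \<in> H \<Longrightarrow> rank T x < rank T h \<or> rank T' x < rank T h \<Longrightarrow>
        rank T' x = rank T x \<and> (edge_of x \<in> T \<longleftrightarrow> edge_of x \<in> T')"
  using assms unfolding diverge_def by blast+

lemma diverge_later:
  assumes T: "spanning_tree T" and T': "spanning_tree T'" and d: "diverge T T' h"
    and x: "x \<in> H" "edge_of x \<in> T'" "edge_of x \<notin> T"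
  shows "rank T h < rank T x" "rank T h < rank T' x"
proof -
  have h: "h \<in> H" "edge_of x \<noteq> edge_of h" using divergeD[OF d] lowD x by auto
  have "\<not> (rank T x < rank T h \<or> rank T' x < rank T h)" using divergeD(6)[OF d x(1)] x by blast
  moreover have "rank T x \<noteq> rank T h" "rank T' x \<noteq> rank T' h"
    using rank_eq_iff[OF T x(1) h(1)] rank_eq_iff[OF T' x(1) h(1)] h by auto
  ultimately show "rank T h < rank T x" "rank T h < rank T' x"
    using divergeD(3)[OF d] by auto
qed

subsection \<open>Tree-intervals\<close>

lemma tree_interval_iff:
  "S \<in> tree_interval T \<longleftrightarrow> T - S \<subseteq> internal_active T \<and> S - T \<subseteq> external_active T"
proof
  assume "S \<in> tree_interval T"
  then obtain A B where "S = (T - A) \<union> B" "A \<subseteq> internal_active T" "B \<subseteq> external_active T"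
    by (auto simp: tree_interval_def)
  then show "T - S \<subseteq> internal_active T \<and> S - T \<subseteq> external_active T" by auto
next
  assume "T - S \<subseteq> internal_active T \<and> S - T \<subseteq> external_active T"
  moreover have "S = (T - (T - S)) \<union> (S - T)" by auto
  ultimately show "S \<in> tree_interval T" unfolding tree_interval_def by blast
qed

text \<open>The path of \<open>T'\<close> from \<open>\<alpha> h\<close> to \<open>h\<close> leaves
  the far side of \<open>h\<close> in \<open>T\<close> through an edge \<open>c\<close> of
  \<open>T'\<close> outside \<open>T\<close>, later than \<open>h\<close> in both orders. If
  \<open>c\<close> lies in \<open>S\<close>, it ought to be active in \<open>T\<close>, yet
  \<open>h\<close> is smaller in its cycle; otherwise it ought to be active in \<open>T'\<close>,
  yet \<open>h\<close> is smaller in its cocycle.\<close>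

lemma tree_intervals_disjoint_if_diverge:
  assumes T: "spanning_tree T" and T': "spanning_tree T'" and d: "diverge T T' h"
    and S: "S \<in> tree_interval T" "S \<in> tree_interval T'"
  shows False
proof -
  note h = divergeD(1-5)[OF d]
  have hH: "h \<in> H" "\<alpha> h \<in> H" "\<alpha> h \<in> below T h" "h \<notin> below T h"
    using h(1) by (auto simp: low_def below_def)
  obtain c where c: "c \<in> H" "c \<in> below T h" "\<alpha> c \<notin> below T h" "edge_of c \<in> T'"
    and cl: "low T' c \<Longrightarrow> \<alpha> h \<notin> below T' c \<and> h \<in> below T' c"
      "low T' (\<alpha> c) \<Longrightarrow> \<alpha> h \<in> below T' (\<alpha> c) \<and> h \<notin> below T' (\<alpha> c)"
    using tree_path_leaves_set[OF T' hH(2,1,3,4)] below_sigma[OF T h(1,4)] by metis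
  have ne: "edge_of c \<noteq> edge_of h" using c h by auto
  have crc: "crosses T h c" using c by (auto simp: crosses_def)
  have cT: "edge_of c \<notin> T" using internal_not_crosses[OF T h(1,4) c(1)] ne crc by blast
  have cS: "edge_of c \<in> edges" using c by simp
  \<comment> \<open>The smaller half-edge of \<open>c\<close> may differ between the two orders,
    hence \<open>a\<close> and \<open>a'\<close>.\<close>
  obtain a where a: "low T a" "edge_of c = edge_of a" by (rule obtain_low[OF T cS])
  obtain a' where a': "low T' a'" "edge_of c = edge_of a'" by (rule obtain_low[OF T' cS])
  have aH: "a \<in> H" "a' \<in> H" using a a' lowD by blast+
  have gt: "rank T h < rank T a" "rank T h < rank T' a'"
    using diverge_later[OF T T' d aH(1)] diverge_later[OF T T' d aH(2)] a a' c cT by auto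
  show False
  proof (cases "edge_of c \<in> S")
    case True
    then have "edge_of a \<in> external_active T" using S(1) cT a by (auto simp: tree_interval_iff)
    moreover have "crosses T h a"
      using crc a(2) aH(1) c(1) by (auto simp: edge_of_eq_iff crosses_alpha)
    ultimately have "rank T a \<le> rank T h"
      using external_active_iff[OF T a(1)] cT a h by auto
    then show False using gt by simp
  next
    case False
    then have "edge_of a' \<in> internal_active T'" using S(2) c a' by (auto simp: tree_interval_iff)
    moreover have "crosses T' a' h"
    proof -
      have "a' = c \<or> a' = \<alpha> c" using a' aH c edge_of_eq_iff by metis
      then show ?thesis using cl a'(1) by (auto simp: crosses_def)
    qed
    ultimately have "rank T' a' \<le> rank T' h"
      using internal_active_iff[OF T' a'(1)] c a' h by auto
    then show False using gt h by simp
  qed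
qed

lemma tree_interval_unique:
  assumes T: "spanning_tree T" and T': "spanning_tree T'"
    and S: "S \<in> tree_interval T" "S \<in> tree_interval T'"
  shows "T = T'"
proof (rule ccontr)
  assume "T \<noteq> T'"
  then obtain h where "diverge T T' h \<or> diverge T' T h" by (rule first_difference[OF T T'])
  then show False
    using tree_intervals_disjoint_if_diverge[OF T T' _ S]
      tree_intervals_disjoint_if_diverge[OF T' T _ S(2,1)] by blast
qed

text \<open>Letters follow the tour of \<open>T\<close>, so the word depends on \<open>T\<close>
  also through its order. With \<open>False < True\<close> the lexicographic order favours early
  disagreement with \<open>S\<close>.\<close>

definition difference_word :: "'h set set \<Rightarrow> 'h set set \<Rightarrow> bool list" where
  "difference_word S T =
     map (\<lambda>i. edge_of (tour T i) \<in> S \<longleftrightarrow> edge_of (tour T i) \<notin> T) [0..<card H]"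

text \<open>\<open>p\<close> and \<open>q\<close> stand for the exchanged edges, \<open>p\<close>
  being the smaller. The tours coincide up to \<open>p\<close>, as neither edge is met before; at
  \<open>p\<close> only \<open>T'\<close> disagrees with \<open>S\<close>.\<close>

lemma difference_word_less:
  assumes T: "spanning_tree T" and p: "low T p"
    and q: "low T q" "rank T p < rank T q"
    and T': "\<And>e. e \<noteq> edge_of p \<Longrightarrow> e \<noteq> edge_of q \<Longrightarrow> e \<in> T' \<longleftrightarrow> e \<in> T"
    and pS: "edge_of p \<in> S \<longleftrightarrow> edge_of p \<in> T" "edge_of p \<in> S \<longleftrightarrow> edge_of p \<notin> T'"
  shows "difference_word S T < difference_word S T'"
proof -
  let ?n = "rank T p"
  let ?w = "\<lambda>T i. edge_of (tour T i) \<in> S \<longleftrightarrow> edge_of (tour T i) \<notin> T"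
  have pH: "p \<in> H" "q \<in> H" using p q lowD by auto
  have agT: "edge_of (tour T i) \<in> T' \<longleftrightarrow> edge_of (tour T i) \<in> T" if "i < ?n" for i
  proof (rule T')
    have r: "rank T (tour T i) = i" using rank_tour[OF T pH(1)] that by simp
    show "edge_of (tour T i) \<noteq> edge_of p" "edge_of (tour T i) \<noteq> edge_of q"
      using r that p q pH by (auto simp: edge_of_eq_iff low_def)
  qed
  have tours: "tour T' i = tour T i" if "i \<le> ?n" for i
    using tours_agree[of ?n T T' i] agT that by blast
  have split: "[0..<card H] = [0..<?n] @ ?n # [Suc ?n..<card H]"
    using rank_less_card[OF T pH(1)] upt_add_eq_append[of 0 ?n "card H - ?n"] upt_conv_Cons[of ?n "card H"] by simp
  have pre: "map (?w T') [0..<?n] = map (?w T) [0..<?n]"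
    using agT tours by auto
  have "\<not> ?w T ?n" "?w T' ?n" using pS tour_rank[OF T pH(1)] tours[of ?n] by auto
  moreover have "us @ False # xs < us @ True # ys" for us xs ys :: "bool list"
    by (induction us) auto
  ultimately show ?thesis
    unfolding difference_word_def split map_append list.map pre by simp
qed

text \<open>Among the spanning trees having the most edges in \<open>S\<close>, the one with the largest difference
  word works: a non-active edge of the symmetric difference with \<open>S\<close> could be exchanged against
  a smaller edge, which moves the difference to an earlier place of the tour.\<close>

lemma exists_tree_interval:
  assumes "S \<subseteq> edges"
  shows "\<exists>T. spanning_tree T \<and> S \<in> tree_interval T"
proof -
  let ?M0 = "{T. spanning_tree T}"
  have fin0: "finite ?M0"
    by (rule finite_subset[of _ "Pow edges"]) (use spanning_treeD(1) finite_edges in auto)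
  have finT: "finite T" if "spanning_tree T" for T
    using spanning_treeD(1)[OF that] finite_edges finite_subset by blast
  define m where "m = Max ((\<lambda>T. card (S \<inter> T)) ` ?M0)"
  have le_m: "card (S \<inter> T) \<le> m" if "spanning_tree T" for T
    unfolding m_def using fin0 that by (intro Max_ge) auto
  have "m \<in> (\<lambda>T. card (S \<inter> T)) ` ?M0"
    unfolding m_def using fin0 exists_spanning_tree by (intro Max_in) auto
  define M where "M = {T. spanning_tree T \<and> card (S \<inter> T) = m}"
  have M: "finite M" "M \<noteq> {}"
    using \<open>m \<in> _\<close> finite_subset[OF _ fin0, of M] by (auto simp: M_def)
  then have "Max (difference_word S ` M) \<in> difference_word S ` M" by (intro Max_in) auto
  then obtain T where TM: "T \<in> M" and max: "difference_word S T = Max (difference_word S ` M)" by auto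
  have T: "spanning_tree T" and cT: "card (S \<inter> T) = m" using TM by (auto simp: M_def)
  have notless: "\<not> difference_word S T < difference_word S T'" if "T' \<in> M" for T'
    unfolding max by (rule leD, rule Max_ge) (use M that in auto)
  \<comment> \<open>Such an exchange cannot lower \<open>card (S \<inter> T)\<close>. As this is
    maximal, the two edges are both in \<open>S\<close> or both outside, and the new tree again
    competes in \<open>M\<close>.\<close>
  have exch: "(edge_of x \<in> S \<longleftrightarrow> edge_of a \<in> S) \<and> insert (edge_of x) (T - {edge_of a}) \<in> M"
    if st: "spanning_tree (insert (edge_of x) (T - {edge_of a}))"
      and a: "edge_of a \<in> T" "edge_of x \<notin> T" and S: "edge_of x \<in> S \<or> edge_of a \<notin> S" for a x
  proof -
    let ?T' = "insert (edge_of x) (T - {edge_of a})"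
    have fin: "finite (S \<inter> T)" using finT[OF T] by simp
    have "S \<inter> ?T' = (if edge_of x \<in> S then insert (edge_of x) (S \<inter> T - {edge_of a})
        else S \<inter> T - {edge_of a})" by auto
    then have "card (S \<inter> ?T') = card (S \<inter> T - {edge_of a}) + (if edge_of x \<in> S then 1 else 0)"
      using fin a by simp
    moreover have "card (S \<inter> T) = card (S \<inter> T - {edge_of a}) + (if edge_of a \<in> S then 1 else 0)"
      using fin a card_Suc_Diff1[OF fin, of "edge_of a"] by simp
    moreover have "card (S \<inter> ?T') \<le> card (S \<inter> T)" using le_m[OF st] cT by simp
    moreover have "(P \<longleftrightarrow> Q) \<and> k = l"
      if "k = p + (if P then 1 else 0)" "l = p + (if Q then 1 else 0)" "k \<le> l" "P \<or> \<not> Q"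
      for P Q and k l p :: nat using that by (auto split: if_splits)
    ultimately have "(edge_of x \<in> S \<longleftrightarrow> edge_of a \<in> S) \<and> card (S \<inter> ?T') = card (S \<inter> T)"
      using S by blast
    then show ?thesis using st cT unfolding M_def by blast
  qed
  have "e \<in> external_active T" if e: "e \<in> S - T" "e \<in> edges" for e
  proof -
    obtain g where g: "low T g" "e = edge_of g" by (rule obtain_low[OF T e(2)])
    have gH: "g \<in> H" using g lowD by blast
    have "rank T g \<le> rank T a" if a: "low T a" "edge_of a \<in> T" "crosses T a g" for a
    proof (rule ccontr)
      assume "\<not> rank T g \<le> rank T a"
      then have lt: "rank T a < rank T g" by simp
      let ?T' = "insert (edge_of g) (T - {edge_of a})"
      have ex: "edge_of g \<in> S \<longleftrightarrow> edge_of a \<in> S" "?T' \<in> M"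
        using exch[of g a] exchange_iff_crosses[OF T a(1,2) gH] a g e by auto
      \<comment> \<open>\<open>a\<close> lies in \<open>S\<close> together with \<open>g\<close>, so
        \<open>T\<close> agrees with \<open>S\<close> at \<open>a\<close> until \<open>a\<close> is
        removed.\<close>
      have "difference_word S T < difference_word S ?T'"
        by (rule difference_word_less[OF T a(1) g(1) lt]) (use ex e g a in auto)
      then show False using notless ex by blast
    qed
    then show ?thesis using external_active_iff[OF T g(1)] g e by auto
  qed
  moreover have "e \<in> internal_active T" if e: "e \<in> T - S" for e
  proof -
    have "e \<in> edges" using e spanning_treeD(1)[OF T] by auto
    then obtain a where a: "low T a" "e = edge_of a" by (rule obtain_low[OF T])
    have "rank T a \<le> rank T g" if g: "low T g" "crosses T a g" for g
    proof (rule ccontr)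
      assume "\<not> rank T a \<le> rank T g"
      then have lt: "rank T g < rank T a" by simp
      have gH: "g \<in> H" using g lowD by blast
      have "edge_of g \<noteq> edge_of a" using low_unique[OF g(1) a(1)] lt by auto
      then have gT: "edge_of g \<notin> T" using internal_not_crosses[OF T a(1) _ gH] e a g by blast
      let ?T' = "insert (edge_of g) (T - {edge_of a})"
      have ex: "edge_of g \<in> S \<longleftrightarrow> edge_of a \<in> S" "?T' \<in> M"
        using exch[of g a] exchange_iff_crosses[OF T a(1) _ gH] a g gT e by auto
      \<comment> \<open>Here \<open>g\<close> lies outside \<open>S\<close> together with
        \<open>a\<close>, so \<open>T\<close> agrees with \<open>S\<close> at \<open>g\<close> until
        \<open>g\<close> is inserted.\<close>
      have "difference_word S T < difference_word S ?T'"
        by (rule difference_word_less[OF T g(1) a(1) lt]) (use ex e g a gT in auto)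
      then show False using notless ex by blast
    qed
    then show ?thesis using internal_active_iff[OF T a(1)] a e by auto
  qed
  ultimately show ?thesis using T assms by (auto simp: tree_interval_iff)
qed

subsection \<open>Directed cycles and cocycles\<close>

text \<open>A digraph on half-edges whose reachability is directed reachability in the oriented
  graph: turning around a vertex is free, and an edge is crossed from tail to head.\<close>

definition arc_steps :: "('h \<Rightarrow> bool) \<Rightarrow> ('h \<times> 'h) set" where
  "arc_steps arc = {(h, \<sigma> h) | h. h \<in> H} \<union> {(h, \<alpha> h) | h. h \<in> H \<and> arc h}"

lemma arc_steps_arc: "h \<in> H \<Longrightarrow> arc h \<Longrightarrow> (h, \<alpha> h) \<in> arc_steps arc"
  by (auto simp: arc_steps_def)

text \<open>The hypotheses say that the tree path from \<open>x\<close> to \<open>y\<close> only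
  climbs towards the root, over edges directed that way. If \<open>y\<close> were not reached, this
  path would leave the reached set at an edge that can in fact be followed.\<close>

lemma leads_up:
  assumes T: "spanning_tree T" and xy: "x \<in> H" "y \<in> H"
    and up: "\<And>a. low T a \<Longrightarrow> edge_of a \<in> T \<Longrightarrow> x \<in> below T a \<Longrightarrow> y \<notin> below T a \<Longrightarrow> arc (\<alpha> a)"
    and down: "\<And>a. low T a \<Longrightarrow> edge_of a \<in> T \<Longrightarrow> y \<in> below T a \<Longrightarrow> x \<in> below T a"
  shows "(x, y) \<in> (arc_steps arc)\<^sup>*"
proof (rule ccontr)
  let ?X = "{h. (x, h) \<in> (arc_steps arc)\<^sup>*}"
  assume "(x, y) \<notin> (arc_steps arc)\<^sup>*"
  then have xX: "x \<in> ?X" "y \<notin> ?X" by auto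
  have "\<sigma> h \<in> ?X" if "h \<in> H" "h \<in> ?X" for h
    using that by (auto simp: arc_steps_def intro: rtrancl.rtrancl_into_rtrancl)
  then obtain c where c: "c \<in> H" "c \<in> ?X" "\<alpha> c \<notin> ?X" "edge_of c \<in> T"
    and cl: "low T c \<Longrightarrow> x \<notin> below T c \<and> y \<in> below T c"
      "low T (\<alpha> c) \<Longrightarrow> x \<in> below T (\<alpha> c) \<and> y \<notin> below T (\<alpha> c)"
    using tree_path_leaves_set[OF T xy xX] by metis
  have "\<not> low T c" using cl(1) down c by blast
  then have "low T (\<alpha> c)" using low_alpha[OF T c(1)] by simp
  then have "arc c" using up[of "\<alpha> c"] cl(2) c by simp
  then show False using c arc_steps_arc[of c arc] by (auto intro: rtrancl.rtrancl_into_rtrancl)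
qed

text \<open>\<open>D\<close> stands for the symmetric difference of a subgraph with its tree \<open>T\<close>, and \<open>arc h\<close> for \<open>h\<close>
  being a tail of the image of the subgraph under \<open>\<Phi>\<close>.\<close>

definition marked :: "'h set set \<Rightarrow> 'h set set \<Rightarrow> ('h \<Rightarrow> bool) \<Rightarrow> bool" where
  "marked T D arc \<longleftrightarrow> spanning_tree T \<and>
     (\<forall>x \<in> H. arc x \<longleftrightarrow> \<not> arc (\<alpha> x)) \<and>
     (\<forall>a. low T a \<and> edge_of a \<in> T \<longrightarrow>
        (arc (\<alpha> a) \<longleftrightarrow> edge_of a \<in> D \<or>
           (\<exists>g. low T g \<and> edge_of g \<notin> T \<and> edge_of g \<in> D \<and> crosses T a g))) \<and>
     (\<forall>g. low T g \<and> edge_of g \<notin> T \<longrightarrow>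
        (arc g \<longleftrightarrow> edge_of g \<in> D \<or>
           (\<exists>a. low T a \<and> edge_of a \<in> T \<and> edge_of a \<in> D \<and> crosses T a g))) \<and>
     (\<forall>a g. low T a \<and> edge_of a \<in> T \<and> low T g \<and> edge_of g \<notin> T \<and> crosses T a g \<longrightarrow>
        (edge_of a \<in> D \<longrightarrow> rank T a < rank T g) \<and> (edge_of g \<in> D \<longrightarrow> rank T g < rank T a))"

lemma markedD:
  assumes "marked T D arc"
  shows "spanning_tree T"
    "x \<in> H \<Longrightarrow> arc x \<longleftrightarrow> \<not> arc (\<alpha> x)"
    "low T a \<Longrightarrow> edge_of a \<in> T \<Longrightarrow> arc (\<alpha> a) \<longleftrightarrow> edge_of a \<in> D \<or>
       (\<exists>g. low T g \<and> edge_of g \<notin> T \<and> edge_of g \<in> D \<and> crosses T a g)"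
    "low T g \<Longrightarrow> edge_of g \<notin> T \<Longrightarrow> arc g \<longleftrightarrow> edge_of g \<in> D \<or>
       (\<exists>a. low T a \<and> edge_of a \<in> T \<and> edge_of a \<in> D \<and> crosses T a g)"
    "low T a \<Longrightarrow> edge_of a \<in> T \<Longrightarrow> low T g \<Longrightarrow> edge_of g \<notin> T \<Longrightarrow> crosses T a g \<Longrightarrow>
       edge_of a \<in> D \<Longrightarrow> rank T a < rank T g"
    "low T a \<Longrightarrow> edge_of a \<in> T \<Longrightarrow> low T g \<Longrightarrow> edge_of g \<notin> T \<Longrightarrow> crosses T a g \<Longrightarrow>
       edge_of g \<in> D \<Longrightarrow> rank T g < rank T a"
proof -
  note m = assms[unfolded marked_def]
  show "spanning_tree T" using m by (rule conjunct1)
  note m = m[THEN conjunct2]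
  show "x \<in> H \<Longrightarrow> arc x \<longleftrightarrow> \<not> arc (\<alpha> x)" using m[THEN conjunct1] by blast
  note m = m[THEN conjunct2]
  show "low T a \<Longrightarrow> edge_of a \<in> T \<Longrightarrow> arc (\<alpha> a) \<longleftrightarrow> edge_of a \<in> D \<or>
      (\<exists>g. low T g \<and> edge_of g \<notin> T \<and> edge_of g \<in> D \<and> crosses T a g)"
    using m[THEN conjunct1, rule_format, OF conjI] .
  note m = m[THEN conjunct2]
  show "low T g \<Longrightarrow> edge_of g \<notin> T \<Longrightarrow> arc g \<longleftrightarrow> edge_of g \<in> D \<or>
      (\<exists>a. low T a \<and> edge_of a \<in> T \<and> edge_of a \<in> D \<and> crosses T a g)"
    using m[THEN conjunct1, rule_format, OF conjI] .
  note m = m[THEN conjunct2]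
  show "low T a \<Longrightarrow> edge_of a \<in> T \<Longrightarrow> low T g \<Longrightarrow> edge_of g \<notin> T \<Longrightarrow> crosses T a g \<Longrightarrow>
      edge_of a \<in> D \<Longrightarrow> rank T a < rank T g"
    and "low T a \<Longrightarrow> edge_of a \<in> T \<Longrightarrow> low T g \<Longrightarrow> edge_of g \<notin> T \<Longrightarrow> crosses T a g \<Longrightarrow>
      edge_of g \<in> D \<Longrightarrow> rank T g < rank T a"
    using m by blast+
qed

lemma crossing_order:
  assumes "low T a" "low T g" "crosses T a g"
  shows "rank T a < rank T g \<Longrightarrow> g \<in> below T a \<and> \<alpha> g \<notin> below T a"
    and "rank T g < rank T a \<Longrightarrow> g \<notin> below T a \<and> \<alpha> g \<in> below T a"
  using assms by (auto simp: crosses_def below_def low_def)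

text \<open>\<open>k\<close> comes before every other edge of its cocycle, so the smaller half-edge
  of such an edge is the one beyond \<open>k\<close>, and \<open>k\<close> in \<open>D\<close> makes
  it the tail. The whole cocycle points out of \<open>below T k\<close>.\<close>

lemma marked_cocycle_directed:
  assumes m: "marked T D arc" and k: "low T k" "edge_of k \<in> T" "edge_of k \<in> D"
    and x: "x \<in> H" "x \<in> below T k" "\<alpha> x \<notin> below T k"
  shows "arc x"
proof (cases "edge_of x = edge_of k")
  case True
  moreover have "x \<noteq> k" using x by (auto simp: below_def)
  ultimately have "x = \<alpha> k" using edge_of_eq_iff[OF x(1)] k lowD by blast
  then show ?thesis using markedD(3)[OF m] k by blast
next
  case False
  note T = markedD(1)[OF m]
  have cr: "crosses T k x" using x by (simp add: crosses_def)
  then have xT: "edge_of x \<notin> T" using internal_not_crosses[OF T k(1,2) x(1)] False by blast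
  have "low T x"
  proof (rule ccontr)
    assume "\<not> low T x"
    then have l: "low T (\<alpha> x)" using low_alpha[OF T x(1)] by simp
    have cr': "crosses T k (\<alpha> x)" using cr crosses_alpha[OF x(1)] by simp
    then have "rank T k < rank T (\<alpha> x)" using markedD(5)[OF m k(1,2) l _ _ k(3)] xT x by simp
    then show False using crossing_order(1)[OF k(1) l cr'] x by simp
  qed
  then show ?thesis using markedD(4)[OF m] xT k cr by blast
qed

definition on_cycle :: "'h set set \<Rightarrow> 'h \<Rightarrow> 'h \<Rightarrow> bool" where
  "on_cycle T f x \<longleftrightarrow> edge_of x = edge_of f \<or>
     (\<exists>a. low T a \<and> edge_of a \<in> T \<and> edge_of a = edge_of x \<and> crosses T a f)"

text \<open>As \<open>f\<close> comes first on its cycle, each cut of a tree edge on the cycle has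
  \<open>f\<close> outside and \<open>\<alpha> f\<close> beyond; these tree edges, all directed
  towards the root, lead from \<open>\<alpha> f\<close> back to \<open>f\<close>. Mutual
  reachability of the ends of an edge is all that the cut argument needs.\<close>

lemma marked_cycle_directed:
  assumes m: "marked T D arc" and f: "low T f" "edge_of f \<notin> T" "edge_of f \<in> D"
    and x: "x \<in> H" "on_cycle T f x"
  shows "(x, \<alpha> x) \<in> (arc_steps arc)\<^sup>*"
proof -
  let ?R = "(arc_steps arc)\<^sup>*"
  note T = markedD(1)[OF m]
  have fH: "f \<in> H" "\<alpha> f \<in> H" using f lowD by auto
  have cyc: "f \<notin> below T a" "\<alpha> f \<in> below T a" "arc (\<alpha> a)" "rank T f < rank T a"
    if "low T a" "edge_of a \<in> T" "crosses T a f" for a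
    using crossing_order(2)[OF that(1) f(1) that(3)] markedD(6)[OF m that(1,2) f(1,2) that(3) f(3)]
      markedD(3)[OF m that(1,2)] f that(3) by blast+
  have "arc f" using markedD(4)[OF m f(1,2)] f by blast
  then have f1: "(f, \<alpha> f) \<in> ?R" using arc_steps_arc[OF fH(1)] by auto
  have inf: "\<alpha> f \<in> below T a" if "low T a" "edge_of a \<in> T" "f \<in> below T a" for a
    using cyc(1)[OF that(1,2)] that(3) by (auto simp: crosses_def)
  have f2: "(\<alpha> f, f) \<in> ?R"
  proof (rule leads_up[OF T fH(2,1)])
    fix a assume a: "low T a" "edge_of a \<in> T"
    show "arc (\<alpha> a)" if "\<alpha> f \<in> below T a" "f \<notin> below T a"
      using cyc(3)[OF a] that by (simp add: crosses_def)
  qed (rule inf)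
  \<comment> \<open>\<open>e\<close> is crossed directly from \<open>\<alpha> e\<close> to
    \<open>e\<close>. The way back climbs from \<open>e\<close> to \<open>f\<close>, crosses
    \<open>f\<close>, and climbs from \<open>\<alpha> f\<close> to
    \<open>\<alpha> e\<close>.\<close>
  have tree: "(e, \<alpha> e) \<in> ?R \<and> (\<alpha> e, e) \<in> ?R" if e: "low T e" "edge_of e \<in> T" "crosses T e f" for e
  proof -
    note ce = cyc[OF e]
    have eH: "e \<in> H" "\<alpha> e \<in> H" using e lowD by auto
    have r: "rank T f < rank T e" "rank T e < rank T (\<alpha> f)" "rank T (\<alpha> f) \<le> rank T (\<alpha> e)"
      using ce by (auto simp: below_def)
    have both: "\<alpha> e \<in> below T a \<longleftrightarrow> e \<in> below T a" if "low T a" "edge_of a \<in> T" "a \<noteq> e" for a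
      using internal_not_crosses[OF T that(1,2) eH(1) e(2)] low_unique[OF e(1) that(1)] that(3)
      by (auto simp: crosses_def)
    have ine: "e \<in> below T a" if a: "low T a" "edge_of a \<in> T" "f \<in> below T a" for a
      using inf[OF a] a(3) r eH by (auto simp: below_def)
    have "(e, f) \<in> ?R"
    proof (rule leads_up[OF T eH(1) fH(1)])
      fix a assume a: "low T a" "edge_of a \<in> T"
      show "arc (\<alpha> a)" if eb: "e \<in> below T a" "f \<notin> below T a"
      proof -
        have "a \<noteq> e" using eb by (auto simp: below_def)
        then have "\<alpha> e \<in> below T a" using both[OF a] eb by simp
        then have "\<alpha> f \<in> below T a" using eb r fH by (auto simp: below_def)
        then show ?thesis using cyc(3)[OF a] eb by (simp add: crosses_def)
      qed
    qed (rule ine)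
    moreover have "(\<alpha> f, \<alpha> e) \<in> ?R"
    proof (rule leads_up[OF T fH(2) eH(2)])
      fix a assume a: "low T a" "edge_of a \<in> T"
      show "arc (\<alpha> a)" if b: "\<alpha> f \<in> below T a" "\<alpha> e \<notin> below T a"
      proof -
        have "a \<noteq> e" using b ce eH by (auto simp: below_def)
        then have "f \<notin> below T a" using ine[OF a] both[OF a] b by blast
        then show ?thesis using cyc(3)[OF a] b by (simp add: crosses_def)
      qed
      show "\<alpha> f \<in> below T a" if b: "\<alpha> e \<in> below T a"
      proof (cases "a = e")
        case False
        then have "e \<in> below T a" using both[OF a] b by simp
        then show ?thesis using b r fH by (auto simp: below_def)
      qed (use ce in simp)
    qed
    moreover have "(\<alpha> e, e) \<in> ?R" using arc_steps_arc[OF eH(2)] ce eH by auto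
    ultimately show ?thesis using f1 by (meson rtrancl_trans)
  qed
  show ?thesis
  proof (cases "edge_of x = edge_of f")
    case True
    then show ?thesis using f1 f2 edge_of_eq_iff[OF x(1) fH(1)] fH by auto
  next
    case False
    then obtain a where a: "low T a" "edge_of a \<in> T" "edge_of a = edge_of x" "crosses T a f"
      using x unfolding on_cycle_def by blast
    then have "x = a \<or> x = \<alpha> a" using edge_of_eq_iff[OF x(1)] lowD by metis
    then show ?thesis using tree[OF a(1,2,4)] lowD(1)[OF a(1)] by auto
  qed
qed

text \<open>All edges of the cocycle point out of \<open>?U\<close>, so a directed walk outside
  \<open>?U\<close> stays outside. The ends of an edge on the cycle reach each other and hence lie
  on the same side. The two trees share nothing but the orientation.\<close>

lemma directed_cycle_cocycle_disjoint:
  assumes m: "marked T D arc" and f: "low T f" "edge_of f \<notin> T" "edge_of f \<in> D"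
    and m': "marked T' D' arc" and k: "low T' k" "edge_of k \<in> T'" "edge_of k \<in> D'"
    and x: "x \<in> H" "on_cycle T f x"
  shows "\<not> crosses T' k x"
proof
  assume cr: "crosses T' k x"
  let ?U = "below T' k"
  have closed: "z \<in> H \<and> z \<notin> ?U" if "(y, z) \<in> (arc_steps arc)\<^sup>*" "y \<in> H" "y \<notin> ?U" for y z
    using that
  proof (induction rule: rtrancl_induct)
    case (step z w)
    then have z: "z \<in> H" "z \<notin> ?U" by auto
    consider "w = \<sigma> z" | "w = \<alpha> z" "arc z" using step.hyps by (auto simp: arc_steps_def)
    then show ?case
    proof cases
      case 1
      then show ?thesis using below_sigma[OF markedD(1)[OF m'] k(1,2)] z by simp
    next
      case 2
      then show ?thesis
        using marked_cocycle_directed[OF m' k, of "\<alpha> z"] markedD(2)[OF m', of z] z by auto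
    qed
  qed simp
  have "on_cycle T f (\<alpha> x)" using x by (simp add: on_cycle_def)
  then have "(x, \<alpha> x) \<in> (arc_steps arc)\<^sup>*" "(\<alpha> x, x) \<in> (arc_steps arc)\<^sup>*"
    using marked_cycle_directed[OF m f] x marked_cycle_directed[OF m f, of "\<alpha> x"] by auto
  then show False using closed[of x "\<alpha> x"] closed[of "\<alpha> x" x] x cr by (auto simp: crosses_def)
qed

section \<open>Recovering the tree and the subgraph from the orientation\<close>

lemma on_cycle_low: "low T a \<Longrightarrow> edge_of a \<in> T \<Longrightarrow> crosses T a f \<Longrightarrow> on_cycle T f a"
  by (auto simp: on_cycle_def)

text \<open>The direction of \<open>h\<close> has a cause: \<open>T'\<close> explains
  \<open>arc h\<close> and \<open>T\<close> explains \<open>arc (\<alpha> h)\<close>, by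
  \<open>h\<close> itself or by another edge of the symmetric difference. In each of the four cases
  an edge \<open>c\<close> of \<open>T'\<close> outside \<open>T\<close>, later than
  \<open>h\<close>, lies on a directed cycle of \<open>T'\<close> and in a directed cocycle of
  \<open>T\<close>, or else activity or the direction of \<open>h\<close> is violated.\<close>

lemma marked_not_diverge:
  assumes m: "marked T D arc" and m': "marked T' D' arc" and d: "diverge T T' h"
  shows False
proof -
  note T = markedD(1)[OF m] and T' = markedD(1)[OF m']
  note h = divergeD(1-5)[OF d]
  let ?n = "rank T h"
  have hH: "h \<in> H" "\<alpha> h \<in> H" and hb: "\<alpha> h \<in> below T h" "h \<notin> below T h"
    using h(1) by (auto simp: low_def below_def)
  \<comment> \<open>A half-edge that is low and earlier than \<open>h\<close> in one order is so in
    both, with the same status: its partner cannot have been visited before it in either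
    tour.\<close>
  have visit: "edge_of f \<in> T \<longleftrightarrow> edge_of f \<in> T'" "low T f" "low T' f" "rank T f = rank T' f"
    if "f \<in> H" "low T f \<and> rank T f < ?n \<or> low T' f \<and> rank T' f < ?n" for f
  proof -
    have eq: "rank T' f = rank T f" "edge_of f \<in> T \<longleftrightarrow> edge_of f \<in> T'"
      using divergeD(6)[OF d that(1)] that by auto
    have "rank T (\<alpha> f) < ?n \<or> rank T' (\<alpha> f) < ?n \<Longrightarrow> rank T' (\<alpha> f) = rank T (\<alpha> f)"
      using divergeD(6)[OF d, of "\<alpha> f"] that by auto
    then have "rank T f < rank T (\<alpha> f) \<and> rank T f < rank T' (\<alpha> f)"
      using that eq unfolding low_def by linarith
    then show "edge_of f \<in> T \<longleftrightarrow> edge_of f \<in> T'" "low T f" "low T' f" "rank T f = rank T' f"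
      using eq that(1) by (auto simp: low_def)
  qed
  have exit: "edge_of c \<notin> T \<and> ?n < rank T c \<and> ?n < rank T (\<alpha> c) \<and> ?n < rank T' c \<and> ?n < rank T' (\<alpha> c)"
    if "low T a" "edge_of a \<in> T" "c \<in> H" "c \<in> below T a" "\<alpha> c \<notin> below T a" "edge_of c \<in> T'"
      "edge_of c \<noteq> edge_of a" for a c
  proof -
    have "crosses T a c" using that by (simp add: crosses_def)
    then have cT: "edge_of c \<notin> T" using internal_not_crosses[OF T that(1,2,3)] that(7) by blast
    then show ?thesis
      using diverge_later[OF T T' d that(3)] diverge_later[OF T T' d, of "\<alpha> c"] that by simp
  qed
  have exit_h: "edge_of c \<notin> T \<and> ?n < rank T c \<and> ?n < rank T (\<alpha> c) \<and> ?n < rank T' c"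
    if "c \<in> H" "c \<in> below T h" "\<alpha> c \<notin> below T h" "edge_of c \<in> T'" for c
  proof -
    have "edge_of c \<noteq> edge_of h" using that(4) h(5) by auto
    from exit[OF h(1,4) that this] show ?thesis by simp
  qed
  have low_exit: "low T c \<and> crosses T h c"
    if "c \<in> H" "c \<in> below T h" "\<alpha> c \<notin> below T h" "?n < rank T (\<alpha> c)" for c
    using that by (auto simp: low_def below_def crosses_def)
  show False
  proof (cases "arc h")
    case True
    then have nah: "\<not> arc (\<alpha> h)" using markedD(2)[OF m hH(1)] by simp
    consider (ext) "edge_of h \<in> D'"
      | (int) f where "low T' f" "edge_of f \<in> T'" "edge_of f \<in> D'" "crosses T' f h"
      using markedD(4)[OF m' h(2,5)] True by blast
    then show False
    proof cases
      case ext
      obtain c where c: "c \<in> H" "c \<in> below T h" "\<alpha> c \<notin> below T h" "edge_of c \<in> T'"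
        and cl: "low T' c \<Longrightarrow> \<alpha> h \<notin> below T' c \<and> h \<in> below T' c"
          "low T' (\<alpha> c) \<Longrightarrow> \<alpha> h \<in> below T' (\<alpha> c) \<and> h \<notin> below T' (\<alpha> c)"
        using tree_path_leaves_set[OF T' hH(2,1) hb] below_sigma[OF T h(1,4)] by metis
      have ex: "edge_of c \<notin> T" "?n < rank T (\<alpha> c)" "?n < rank T' c"
        using exit_h[OF c] by auto
      \<comment> \<open>If \<open>c\<close> were low in \<open>T'\<close>, then \<open>h\<close>
        would be beyond it and hence visited after \<open>c\<close>, but \<open>c\<close> is later
        than \<open>h\<close>.\<close>
      have "\<not> low T' c" using cl(1) ex h(3) by (auto simp: below_def)
      then have lc: "low T' (\<alpha> c)" using low_alpha[OF T' c(1)] by simp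
      have cT': "edge_of (\<alpha> c) \<in> T'" using c by simp
      have crc: "crosses T' (\<alpha> c) h" using cl(2)[OF lc] by (simp add: crosses_def)
      have "arc c" using markedD(3)[OF m' lc cT'] h(2,5) ext crc c(1) by auto
      have lTc: "low T c" "crosses T h c" using low_exit[OF c(1,2,3) ex(2)] by auto
      consider "edge_of c \<in> D" | k where "low T k" "edge_of k \<in> T" "edge_of k \<in> D" "crosses T k c"
        using markedD(4)[OF m lTc(1) ex(1)] \<open>arc c\<close> by blast
      then show False
      proof cases
        case 1
        then show False using markedD(3)[OF m h(1,4)] lTc ex nah by blast
      next
        case 2
        have "on_cycle T' h (\<alpha> c)" using on_cycle_low[OF lc cT' crc] .
        then show False
          using directed_cycle_cocycle_disjoint[OF m' h(2,5) ext m 2(1-3), of "\<alpha> c"] 2(4) c(1)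
            crosses_alpha by simp
      qed
    next
      case int
      have fH: "f \<in> H" "\<alpha> f \<in> H" using int lowD by auto
      have fn: "rank T' f < ?n" using markedD(5)[OF m' int(1,2) h(2,5) int(4,3)] h(3) by simp
      note fv = visit[OF fH(1)]
      have f: "edge_of f \<in> T" "low T f" "rank T f < ?n" using fv fn int by auto
      have hb': "h \<in> below T' f" "\<alpha> h \<notin> below T' f"
        using crossing_order(1)[OF int(1) h(2) int(4)] fn h(3) by auto
      have "arc (\<alpha> f)" using markedD(3)[OF m' int(1,2)] int by blast
      then have "edge_of f \<in> D \<or> (\<exists>g. low T g \<and> edge_of g \<notin> T \<and> edge_of g \<in> D \<and> crosses T f g)"
        using markedD(3)[OF m f(2,1)] by blast
      \<comment> \<open>Were the cause another edge \<open>g\<close> of \<open>D\<close>, then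
        \<open>f\<close> would lie on the directed cycle of \<open>g\<close> in \<open>T\<close> and
        in its own directed cocycle in \<open>T'\<close>.\<close>
      then have fD: "edge_of f \<in> D"
        using directed_cycle_cocycle_disjoint[OF m _ _ _ m' int(1-3) fH(1)]
          on_cycle_low[OF f(2,1)] crosses_self[OF int(1)] by blast
      have "?n \<le> rank T (\<alpha> f)"
      proof (rule ccontr)
        assume "\<not> ?n \<le> rank T (\<alpha> f)"
        then have "rank T' (\<alpha> f) < ?n" using divergeD(6)[OF d fH(2)] by auto
        then show False using hb'(1) h(3) by (simp add: below_def)
      qed
      then have hf: "h \<in> below T f" using f(3) hH by (simp add: below_def)
      have "edge_of h \<noteq> edge_of f" using h int by auto
      then have haf: "\<alpha> h \<in> below T f"
        using internal_not_crosses[OF T f(2,1) hH(1) h(4)] hf by (auto simp: crosses_def)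
      have ff: "f \<notin> below T f" by (simp add: below_def)
      \<comment> \<open>The cut is that of \<open>f\<close>, not of \<open>h\<close>: in
        \<open>T\<close> both ends of \<open>h\<close> lie beyond \<open>f\<close>, while in
        \<open>T'\<close> only \<open>h\<close> does. So the path of \<open>T'\<close> starts at
        \<open>\<alpha> h\<close> and ends at \<open>f\<close>.\<close>
      obtain c where c: "c \<in> H" "c \<in> below T f" "\<alpha> c \<notin> below T f" "edge_of c \<in> T'"
        and cl: "low T' c \<Longrightarrow> \<alpha> h \<notin> below T' c \<and> f \<in> below T' c"
          "low T' (\<alpha> c) \<Longrightarrow> \<alpha> h \<in> below T' (\<alpha> c) \<and> f \<notin> below T' (\<alpha> c)"
        using tree_path_leaves_set[OF T' hH(2) fH(1) haf ff] below_sigma[OF T f(2,1)] by metis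
      have "edge_of c \<noteq> edge_of f"
      proof
        assume "edge_of c = edge_of f"
        then have "c = \<alpha> f" using edge_of_eq_iff[OF c(1) fH(1)] c(2) ff by auto
        then show False using cl(2) int(1) fH hb'(2) by simp
      qed
      then have ex: "edge_of c \<notin> T" "?n < rank T' c" "?n < rank T' (\<alpha> c)"
        using exit[OF f(2,1) c] by auto
      have "arc c" using marked_cocycle_directed[OF m f(2,1) fD c(1-3)] .
      have "\<not> low T' c" using cl(1) ex fn by (auto simp: below_def)
      then have lc: "low T' (\<alpha> c)" using low_alpha[OF T' c(1)] by simp
      have cT': "edge_of (\<alpha> c) \<in> T'" using c by simp
      consider "edge_of (\<alpha> c) \<in> D'"
        | g where "low T' g" "edge_of g \<notin> T'" "edge_of g \<in> D'" "crosses T' (\<alpha> c) g"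
        using markedD(3)[OF m' lc cT'] \<open>arc c\<close> c(1) by auto
      then show False
      proof cases
        case 1
        have "h \<notin> below T' (\<alpha> c)" using ex h(3) by (simp add: below_def)
        then have "crosses T' (\<alpha> c) h" using cl(2)[OF lc] by (simp add: crosses_def)
        then show False using markedD(5)[OF m' lc cT' h(2,5) _ 1] ex h(3) by simp
      next
        case 2
        have "crosses T f c" using c by (simp add: crosses_def)
        then show False
          using directed_cycle_cocycle_disjoint[OF m' 2(1-3) m f(2,1) fD, of "\<alpha> c"]
            on_cycle_low[OF lc cT' 2(4)] c(1) crosses_alpha by simp
      qed
    qed
  next
    case False
    then have ah: "arc (\<alpha> h)" using markedD(2)[OF m hH(1)] by simp
    consider (int) "edge_of h \<in> D"
      | (ext) f where "low T f" "edge_of f \<notin> T" "edge_of f \<in> D" "crosses T h f"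
      using markedD(3)[OF m h(1,4)] ah by blast
    then show False
    proof cases
      case int
      obtain c where c: "c \<in> H" "c \<in> below T h" "\<alpha> c \<notin> below T h" "edge_of c \<in> T'"
        and cl: "low T' c \<Longrightarrow> \<alpha> h \<notin> below T' c \<and> h \<in> below T' c"
          "low T' (\<alpha> c) \<Longrightarrow> \<alpha> h \<in> below T' (\<alpha> c) \<and> h \<notin> below T' (\<alpha> c)"
        using tree_path_leaves_set[OF T' hH(2,1) hb] below_sigma[OF T h(1,4)] by metis
      have ex: "?n < rank T' c" using exit_h[OF c] by auto
      have "arc c" using marked_cocycle_directed[OF m h(1,4) int c(1-3)] .
      have "\<not> low T' c" using cl(1) ex h(3) by (auto simp: below_def)
      then have lc: "low T' (\<alpha> c)" using low_alpha[OF T' c(1)] by simp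
      have cT': "edge_of (\<alpha> c) \<in> T'" using c by simp
      have crc: "crosses T' (\<alpha> c) h" using cl(2)[OF lc] by (simp add: crosses_def)
      consider "edge_of (\<alpha> c) \<in> D'"
        | g where "low T' g" "edge_of g \<notin> T'" "edge_of g \<in> D'" "crosses T' (\<alpha> c) g"
        using markedD(3)[OF m' lc cT'] \<open>arc c\<close> c(1) by auto
      then show False
      proof cases
        case 1
        then show False using markedD(4)[OF m' h(2,5)] lc cT' crc False by blast
      next
        case 2
        have "crosses T h c" using c by (simp add: crosses_def)
        then show False
          using directed_cycle_cocycle_disjoint[OF m' 2(1-3) m h(1,4) int, of "\<alpha> c"]
            on_cycle_low[OF lc cT' 2(4)] c(1) crosses_alpha by simp
      qed
    next
      case ext
      have fH: "f \<in> H" "\<alpha> f \<in> H" using ext lowD by auto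
      have fn: "rank T f < ?n" using markedD(6)[OF m h(1,4) ext(1,2,4,3)] .
      have f: "edge_of f \<notin> T'" "low T' f" using visit[OF fH(1)] fn ext by auto
      have fb: "\<alpha> f \<in> below T h" "f \<notin> below T h"
        using crossing_order(2)[OF h(1) ext(1,4) fn] by auto
      have "arc f" using markedD(4)[OF m ext(1,2)] ext by blast
      then have "edge_of f \<in> D' \<or>
          (\<exists>k. low T' k \<and> edge_of k \<in> T' \<and> edge_of k \<in> D' \<and> crosses T' k f)"
        using markedD(4)[OF m' f(2,1)] by blast
      \<comment> \<open>Otherwise \<open>f\<close> would lie on its own directed cycle in
        \<open>T\<close> and in the directed cocycle of \<open>k\<close> in
        \<open>T'\<close>.\<close>
      then have fD': "edge_of f \<in> D'"
        using directed_cycle_cocycle_disjoint[OF m ext(1-3) m' _ _ _ fH(1)]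
        by (auto simp: on_cycle_def)
      obtain c where c: "c \<in> H" "c \<in> below T h" "\<alpha> c \<notin> below T h" "edge_of c \<in> T'"
        and cl: "low T' c \<Longrightarrow> \<alpha> f \<notin> below T' c \<and> f \<in> below T' c"
          "low T' (\<alpha> c) \<Longrightarrow> \<alpha> f \<in> below T' (\<alpha> c) \<and> f \<notin> below T' (\<alpha> c)"
        using tree_path_leaves_set[OF T' fH(2,1) fb] below_sigma[OF T h(1,4)] by metis
      have ex: "edge_of c \<notin> T" "?n < rank T (\<alpha> c)" "?n < rank T c" "?n < rank T' c"
        using exit_h[OF c] by auto
      have "\<not> low T' c" using cl(1) ex fn visit(4)[OF fH(1)] ext(1) by (auto simp: below_def)
      then have lc: "low T' (\<alpha> c)" using low_alpha[OF T' c(1)] by simp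
      have cT': "edge_of (\<alpha> c) \<in> T'" using c by simp
      have crc: "crosses T' (\<alpha> c) f" using cl(2)[OF lc] by (simp add: crosses_def)
      have "arc c" using markedD(3)[OF m' lc cT'] f fD' crc c(1) by auto
      have lTc: "low T c" "crosses T h c" using low_exit[OF c(1,2,3) ex(2)] by auto
      consider "edge_of c \<in> D" | k where "low T k" "edge_of k \<in> T" "edge_of k \<in> D" "crosses T k c"
        using markedD(4)[OF m lTc(1) ex(1)] \<open>arc c\<close> by blast
      then show False
      proof cases
        case 1
        then show False using markedD(6)[OF m h(1,4) lTc(1) ex(1) lTc(2)] ex by simp
      next
        case 2
        then show False
          using directed_cycle_cocycle_disjoint[OF m' f(2,1) fD' m 2(1-3), of "\<alpha> c"]
            on_cycle_low[OF lc cT' crc] c(1) crosses_alpha by simp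
      qed
    qed
  qed
qed

lemma marked_unique_tree:
  assumes "marked T D arc" "marked T' D' arc"
  shows "T = T'"
proof (rule ccontr)
  assume "T \<noteq> T'"
  then obtain h where "diverge T T' h \<or> diverge T' T h"
    by (rule first_difference[OF assms[THEN markedD(1)]])
  then show False using marked_not_diverge assms by blast
qed

text \<open>If an edge of \<open>D\<close> outside \<open>D'\<close> owed its direction in the
  second marking to an edge of \<open>D'\<close>, each of the two would have to precede the other:
  the first is active through \<open>D\<close>, the second through \<open>D'\<close>.\<close>

lemma marked_same_tree_subset:
  assumes m: "marked T D arc" and m': "marked T D' arc" and D: "D \<subseteq> edges"
  shows "D \<subseteq> D'"
proof
  fix e assume e: "e \<in> D"
  note T = markedD(1)[OF m]
  obtain x where x: "low T x" "e = edge_of x" using obtain_low[OF T] e D by blast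
  show "e \<in> D'"
  proof (cases "e \<in> T")
    case True
    then have "arc (\<alpha> x)" using markedD(3)[OF m] x e by blast
    then show ?thesis
      using markedD(3)[OF m' x(1)] markedD(5)[OF m x(1)] markedD(6)[OF m' x(1)] True x e
      by (meson less_asym)
  next
    case False
    then have "arc x" using markedD(4)[OF m] x e by blast
    then show ?thesis
      using markedD(4)[OF m' x(1)] markedD(6)[OF m _ _ x(1)] markedD(5)[OF m' _ _ x(1)] False x e
      by (meson less_asym)
  qed
qed

section \<open>Bijectivity of \<Phi>\<close>

lemma tree_of_props:
  assumes "S \<in> subgraphs"
  shows "spanning_tree (tree_of S)" "S \<in> tree_interval (tree_of S)"
proof -
  have "\<exists>!T. spanning_tree T \<and> S \<in> tree_interval T"
    using exists_tree_interval[of S] tree_interval_unique assms unfolding subgraphs_def by blast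
  then have "spanning_tree (tree_of S) \<and> S \<in> tree_interval (tree_of S)"
    unfolding tree_of_def by (rule theI')
  then show "spanning_tree (tree_of S)" "S \<in> tree_interval (tree_of S)" by auto
qed

lemma Phi_low:
  assumes T: "T = tree_of S" and a: "low T a"
  shows "\<Phi> S (edge_of a) = (if (edge_of a \<in> T \<and>
      fundamental_cocycle T (edge_of a) \<inter> ((S - T) \<union> (T - S)) = {}) \<or>
      (edge_of a \<notin> T \<and> fundamental_cycle T (edge_of a) \<inter> ((S - T) \<union> (T - S)) \<noteq> {})
      then (a, \<alpha> a) else (\<alpha> a, a))"
  using lowD(1)[OF a] smaller_half_edge_low[OF a] unfolding \<Phi>_def T by (simp add: Let_def)

lemma Phi_marked:
  assumes S: "S \<in> subgraphs"
  defines "T \<equiv> tree_of S"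
  shows "marked T ((S - T) \<union> (T - S)) (\<lambda>x. \<Phi> S (edge_of x) = (x, \<alpha> x))"
proof -
  let ?D = "(S - T) \<union> (T - S)" and ?arc = "\<lambda>x. \<Phi> S (edge_of x) = (x, \<alpha> x)"
  have T: "spanning_tree T" and SI: "S \<in> tree_interval T"
    using tree_of_props[OF S] by (auto simp: T_def)
  have DE: "?D \<subseteq> edges" using S spanning_treeD(1)[OF T] by (auto simp: subgraphs_def)
  have ne: "a \<noteq> \<alpha> a" if "low T a" for a using that by (auto simp: low_def)
  have arcs: "?arc a \<longleftrightarrow> \<not> ?arc (\<alpha> a)" if "low T a" for a
    using Phi_low[OF T_def[THEN meta_eq_to_obj_eq] that] ne[OF that] lowD(1)[OF that] by auto
  have tails: "?arc x \<longleftrightarrow> \<not> ?arc (\<alpha> x)" if "x \<in> H" for x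
    using arcs[of x] arcs[of "\<alpha> x"] low_alpha[OF T that] that by auto
  have int: "?arc (\<alpha> a) \<longleftrightarrow> edge_of a \<in> ?D \<or>
      (\<exists>g. low T g \<and> edge_of g \<notin> T \<and> edge_of g \<in> ?D \<and> crosses T a g)"
    if a: "low T a" "edge_of a \<in> T" for a
  proof -
    have "?arc (\<alpha> a) \<longleftrightarrow> fundamental_cocycle T (edge_of a) \<inter> ?D \<noteq> {}"
      using arcs[OF a(1)] Phi_low[OF T_def[THEN meta_eq_to_obj_eq] a(1)] a ne[OF a(1)]
      by (metis (no_types, lifting) Pair_inject)
    also have "\<dots> \<longleftrightarrow> (\<exists>g. low T g \<and> edge_of g \<in> ?D \<and> crosses T a g)"
    proof
      assume "fundamental_cocycle T (edge_of a) \<inter> ?D \<noteq> {}"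
      then obtain e where e: "e \<in> fundamental_cocycle T (edge_of a)" "e \<in> ?D" by blast
      then obtain g where "low T g" "e = edge_of g" using obtain_low[OF T] DE by blast
      then show "\<exists>g. low T g \<and> edge_of g \<in> ?D \<and> crosses T a g"
        using e fundamental_cocycle_iff[OF T a] lowD by blast
    next
      assume "\<exists>g. low T g \<and> edge_of g \<in> ?D \<and> crosses T a g"
      then show "fundamental_cocycle T (edge_of a) \<inter> ?D \<noteq> {}"
        using fundamental_cocycle_iff[OF T a] lowD by blast
    qed
    \<comment> \<open>The only tree edge in the cocycle of \<open>a\<close> is that of
      \<open>a\<close> itself.\<close>
    also have "\<dots> \<longleftrightarrow> edge_of a \<in> ?D \<or>
        (\<exists>g. low T g \<and> edge_of g \<notin> T \<and> edge_of g \<in> ?D \<and> crosses T a g)"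
      using internal_not_crosses[OF T a] crosses_self[OF a(1)] a(1) lowD(1) by metis
    finally show ?thesis .
  qed
  have ext: "?arc g \<longleftrightarrow> edge_of g \<in> ?D \<or>
      (\<exists>a. low T a \<and> edge_of a \<in> T \<and> edge_of a \<in> ?D \<and> crosses T a g)"
    if g: "low T g" "edge_of g \<notin> T" for g
  proof -
    have "?arc g \<longleftrightarrow> fundamental_cycle T (edge_of g) \<inter> ?D \<noteq> {}"
      using Phi_low[OF T_def[THEN meta_eq_to_obj_eq] g(1)] g ne[OF g(1)] by auto
    also have "\<dots> \<longleftrightarrow> (\<exists>x. low T x \<and> edge_of x \<in> ?D \<and> edge_of x \<in> fundamental_cycle T (edge_of g))"
    proof -
      have "\<exists>x. low T x \<and> e = edge_of x" if "e \<in> ?D" for e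
        using obtain_low[OF T, of e] DE that by blast
      then show ?thesis by blast
    qed
    also have "\<dots> \<longleftrightarrow> edge_of g \<in> ?D \<or>
        (\<exists>a. low T a \<and> edge_of a \<in> T \<and> edge_of a \<in> ?D \<and> crosses T a g)"
      using fundamental_cycle_iff[OF T lowD(1)[OF g(1)] g(2)] g(1) by metis
    finally show ?thesis .
  qed
  have active: "(edge_of a \<in> ?D \<longrightarrow> rank T a < rank T g) \<and> (edge_of g \<in> ?D \<longrightarrow> rank T g < rank T a)"
    if ag: "low T a" "edge_of a \<in> T" "low T g" "edge_of g \<notin> T" "crosses T a g" for a g
  proof -
    \<comment> \<open>Activity gives only \<open>\<le>\<close>; strictness comes from one edge being
      internal and the other external.\<close>
    have "rank T a \<noteq> rank T g" using rank_eq_iff[OF T] ag lowD by metis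
    moreover have "edge_of a \<in> ?D \<Longrightarrow> rank T a \<le> rank T g"
      using SI internal_active_iff[OF T ag(1,2)] ag by (auto simp: tree_interval_iff)
    moreover have "edge_of g \<in> ?D \<Longrightarrow> rank T g \<le> rank T a"
      using SI external_active_iff[OF T ag(3,4)] ag by (auto simp: tree_interval_iff)
    ultimately show ?thesis by auto
  qed
  show ?thesis
    unfolding marked_def
    by (intro conjI ballI allI impI T)
      ((elim conjE)?, (rule tails int ext active[THEN conjunct1, THEN mp]
         active[THEN conjunct2, THEN mp]; assumption))+
qed

lemma inj_on_Phi: "inj_on \<Phi> subgraphs"
proof (rule inj_onI)
  fix S S' assume S: "S \<in> subgraphs" "S' \<in> subgraphs" "\<Phi> S = \<Phi> S'"
  let ?T = "tree_of S" and ?T' = "tree_of S'"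
  note m = Phi_marked[OF S(1)] and m' = Phi_marked[OF S(2), folded S(3)]
  have eq: "?T' = ?T" using marked_unique_tree[OF m m'] by simp
  have sub: "?T \<subseteq> edges" using spanning_treeD(1) tree_of_props(1)[OF S(1)] by blast
  have D: "(S - ?T) \<union> (?T - S) \<subseteq> edges" "(S' - ?T) \<union> (?T - S') \<subseteq> edges"
    using S sub by (auto simp: subgraphs_def)
  have "(S - ?T) \<union> (?T - S) = (S' - ?T) \<union> (?T - S')"
    using marked_same_tree_subset[OF m m'[unfolded eq] D(1)]
      marked_same_tree_subset[OF m'[unfolded eq] m D(2)] by (rule subset_antisym)
  then show "S = S'" by blast
qed

lemma Phi_in_orientations:
  assumes S: "S \<in> subgraphs"
  shows "\<Phi> S \<in> orientations"
  unfolding orientations_def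
proof (rule PiE_I)
  fix e assume "e \<in> edges"
  then obtain a where a: "low (tree_of S) a" "e = edge_of a"
    by (rule obtain_low[OF tree_of_props(1)[OF S]])
  then show "\<Phi> S e \<in> {(h, h'). e = {h, h'}}"
    using Phi_low[OF refl a(1)] by (auto simp: edge_of_def)
next
  fix e assume "e \<notin> edges"
  then show "\<Phi> S e = undefined" by (simp add: \<Phi>_def)
qed

text \<open>Loops also have two (tail, head) pairs, since \<open>\<alpha>\<close> has no fixed
  point; both sets have \<open>2 ^ card edges\<close> elements.\<close>

lemma card_orientations: "card orientations = card subgraphs"
proof -
  have "card {(h, h'). e = {h, h'}} = 2" if "e \<in> edges" for e :: "'h set"
  proof -
    obtain a where a: "a \<in> H" "e = edge_of a" using \<open>e \<in> edges\<close> by (rule edgesE)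
    then have "{(h, h'). e = {h, h'}} = {(a, \<alpha> a), (\<alpha> a, a)}"
      by (auto simp: edge_of_def doubleton_eq_iff)
    then show ?thesis using alpha_no_fixpoint[OF a(1)] by simp
  qed
  then have "card orientations = 2 ^ card edges"
    unfolding orientations_def by (simp add: card_PiE finite_edges)
  then show ?thesis by (simp add: subgraphs_def card_Pow finite_edges)
qed

lemma bij_betw_Phi: "bij_betw \<Phi> subgraphs orientations"
proof -
  have "card orientations > 0"
    unfolding card_orientations subgraphs_def by (simp add: card_Pow finite_edges)
  then have "finite orientations" by (rule card_ge_0_finite)
  moreover have "\<Phi> ` subgraphs \<subseteq> orientations" using Phi_in_orientations by blast
  ultimately have "\<Phi> ` subgraphs = orientations"
    using card_image[OF inj_on_Phi] card_orientations by (intro card_subset_eq) auto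
  then show ?thesis using inj_on_Phi by (simp add: bij_betw_def)
qed

end

theorem theorem20:
  fixes H :: "'h set" and \<sigma> \<alpha> :: "'h \<Rightarrow> 'h" and h0 :: 'h
  assumes "rooted_map H \<sigma> \<alpha> h0"
  shows "bij_betw (rooted_map.\<Phi> H \<sigma> \<alpha> h0) (rooted_map.subgraphs H \<alpha>) (rooted_map.orientations H \<alpha>)"
  using rooted_map.bij_betw_Phi[OF assms] .

end
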